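(* Let $G$ be a finite group, let $\mathbb{K}$ be a field whose characteristic does not divide $|G|$, let $\rho$ be a finite-dimensional representation (possibly reducible) of $G$ over $\mathbb{K}$, and let $\boldsymbol{\mu}$ be an invertible element of $Z(\mathbb{K}[G])$. Let $A=Z(\mathbb{K}[G])$, with $l_A(x)$ equal to the value (coefficient) of $\boldsymbol{\mu}^2x/|G|$ at the unit element of $G$. Let $B=\mathrm{End}_G(\rho)$ be the algebra of intertwining operators on $\rho$, with $l_B(x)=\mathrm{Tr}_\rho(\boldsymbol{\mu}x/|G|)$, where $\boldsymbol{\mu}$ acts on $\rho$ via $\rho$. Let $\phi:A\to B$ be the map given by the action of the center of $\mathbb{K}[G]$ on $\rho$. Then $H^\rho_{\boldsymbol{\mu}}=((A,l_A),(B,l_B),\phi)$ is a semi-simple Cardy--Frobenius algebra over $\mathbb{K}$.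
   Context: All algebras are finite-dimensional, associative and unital over a field $\mathbb{K}$. A Frobenius pair $(C,l_C)$ is an algebra $C$ with a linear functional $l_C:C\to\mathbb{K}$ such that the bilinear form $(c_1,c_2)_C=l_C(c_1c_2)$ is symmetric and non-degenerate. A Cardy--Frobenius algebra $((A,l_A),(B,l_B),\phi)$ consists of: (1) a commutative Frobenius pair $(A,l_A)$; (2) a Frobenius pair $(B,l_B)$, not necessarily commutative; (3) an algebra homomorphism $\phi:A\to B$ whose image is contained in the center of $B$ and which satisfies the Cardy condition $(\phi^*(b'),\phi^*(b''))_A=\mathrm{Tr}\,W^B_{b'b''}$ for all $b',b''\in B$. Here $\phi^*:B\to A$ is the dual map, defined by $(\phi^*(b),a)_A=(b,\phi(a))_B$, and $W^B_{b'b''}:B\to B$ is the linear operator $b\mapsto b'bb''$. It is semi-simple if the algebras $A$ and $B$ are semi-simple. *)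

theory Defs
  imports
    "HOL-Algebra.Group"
    "HOL-Library.FuncSet"
    "HOL-Library.Function_Algebras"
    Complex_Main
begin

text \<open>
  The trace of a linear operator on a finite-dimensional subspace \<open>S\<close>: the sum of the diagonal
  coefficients with respect to a basis of \<open>S\<close>. Only the values of \<open>f\<close> on \<open>S\<close> matter, and the
  chosen basis does not matter when \<open>f\<close> is linear and maps \<open>S\<close> into itself.
\<close>

definition (in vector_space) trace_on :: "'b set \<Rightarrow> ('b \<Rightarrow> 'b) \<Rightarrow> 'a" where
  "trace_on S f =
     (let E = (SOME E. independent E \<and> span E = S) in \<Sum>e\<in>E. representation E (f e) e)"


text \<open>
  An algebra over the field \<open>'k\<close> lives on a linear subspace \<open>alg_space\<close> of an ambient \<open>'k\<close>-vector
  space \<open>'a\<close>; addition is that of \<open>'a\<close>. The multiplication is constrained on \<open>alg_space\<close> only.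
\<close>

record ('k, 'a) alg =
  alg_scale :: "'k \<Rightarrow> 'a \<Rightarrow> 'a"
  alg_space :: "'a set"
  alg_mult :: "'a \<Rightarrow> 'a \<Rightarrow> 'a"
  alg_one :: 'a

locale fd_algebra = vector_space "alg_scale A"
  for A :: "('k::field, 'a::ab_group_add) alg" +
  assumes subspace_space: "subspace (alg_space A)"
    and finite_dim: "\<exists>F. finite F \<and> span F = alg_space A"
    and mult_closed: "\<lbrakk>x \<in> alg_space A; y \<in> alg_space A\<rbrakk> \<Longrightarrow> alg_mult A x y \<in> alg_space A"
    and one_closed: "alg_one A \<in> alg_space A"
    and mult_assoc: "\<lbrakk>x \<in> alg_space A; y \<in> alg_space A; z \<in> alg_space A\<rbrakk> \<Longrightarrow>
      alg_mult A (alg_mult A x y) z = alg_mult A x (alg_mult A y z)"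
    and one_left: "x \<in> alg_space A \<Longrightarrow> alg_mult A (alg_one A) x = x"
    and one_right: "x \<in> alg_space A \<Longrightarrow> alg_mult A x (alg_one A) = x"
    and distrib_right: "\<lbrakk>x \<in> alg_space A; y \<in> alg_space A; z \<in> alg_space A\<rbrakk> \<Longrightarrow>
      alg_mult A (x + y) z = alg_mult A x z + alg_mult A y z"
    and distrib_left: "\<lbrakk>x \<in> alg_space A; y \<in> alg_space A; z \<in> alg_space A\<rbrakk> \<Longrightarrow>
      alg_mult A x (y + z) = alg_mult A x y + alg_mult A x z"
    and scale_mult_left: "\<lbrakk>x \<in> alg_space A; y \<in> alg_space A\<rbrakk> \<Longrightarrow>
      alg_mult A (alg_scale A c x) y = alg_scale A c (alg_mult A x y)"
    and scale_mult_right: "\<lbrakk>x \<in> alg_space A; y \<in> alg_space A\<rbrakk> \<Longrightarrow>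
      alg_mult A x (alg_scale A c y) = alg_scale A c (alg_mult A x y)"

definition alg_commutative :: "('k, 'a) alg \<Rightarrow> bool" where
  "alg_commutative A \<longleftrightarrow>
     (\<forall>x\<in>alg_space A. \<forall>y\<in>alg_space A. alg_mult A x y = alg_mult A y x)"

definition alg_center :: "('k, 'a) alg \<Rightarrow> 'a set" where
  "alg_center A = {z \<in> alg_space A. \<forall>x\<in>alg_space A. alg_mult A z x = alg_mult A x z}"

definition center_algebra :: "('k, 'a) alg \<Rightarrow> ('k, 'a) alg" where
  "center_algebra A = A\<lparr>alg_space := alg_center A\<rparr>"

definition alg_invertible :: "('k, 'a) alg \<Rightarrow> 'a \<Rightarrow> bool" where
  "alg_invertible A x \<longleftrightarrow> x \<in> alg_space A \<and>
     (\<exists>y\<in>alg_space A. alg_mult A x y = alg_one A \<and> alg_mult A y x = alg_one A)"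

definition alg_hom ::
  "('k::field, 'a::ab_group_add) alg \<Rightarrow> ('k, 'b::ab_group_add) alg \<Rightarrow> ('a \<Rightarrow> 'b) \<Rightarrow> bool" where
  "alg_hom A B \<phi> \<longleftrightarrow>
     (\<forall>x\<in>alg_space A. \<phi> x \<in> alg_space B) \<and>
     (\<forall>x\<in>alg_space A. \<forall>y\<in>alg_space A. \<phi> (x + y) = \<phi> x + \<phi> y) \<and>
     (\<forall>c. \<forall>x\<in>alg_space A. \<phi> (alg_scale A c x) = alg_scale B c (\<phi> x)) \<and>
     (\<forall>x\<in>alg_space A. \<forall>y\<in>alg_space A. \<phi> (alg_mult A x y) = alg_mult B (\<phi> x) (\<phi> y)) \<and>
     \<phi> (alg_one A) = alg_one B"


text \<open>
  An algebra is semi-simple if its left regular module is a direct sum of simple modules. The simple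
  submodules of the regular module are the minimal left ideals, and finitely many summands suffice
  because the algebra is finite-dimensional. The zero algebra is semi-simple (empty sum).
\<close>

definition left_ideal :: "('k::field, 'a::ab_group_add) alg \<Rightarrow> 'a set \<Rightarrow> bool" where
  "left_ideal A I \<longleftrightarrow> module.subspace (alg_scale A) I \<and> I \<subseteq> alg_space A \<and>
     (\<forall>a\<in>alg_space A. \<forall>x\<in>I. alg_mult A a x \<in> I)"

definition minimal_left_ideal :: "('k::field, 'a::ab_group_add) alg \<Rightarrow> 'a set \<Rightarrow> bool" where
  "minimal_left_ideal A I \<longleftrightarrow> left_ideal A I \<and> I \<noteq> {0} \<and>
     (\<forall>J. left_ideal A J \<and> J \<subseteq> I \<longrightarrow> J = {0} \<or> J = I)"

definition semisimple_alg :: "('k::field, 'a::ab_group_add) alg \<Rightarrow> bool" where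
  "semisimple_alg A \<longleftrightarrow>
     (\<exists>(n::nat) L. (\<forall>i<n. minimal_left_ideal A (L i)) \<and>
        (\<forall>x\<in>alg_space A. \<exists>!f. f \<in> (\<Pi>\<^sub>E i\<in>{..<n}. L i) \<and> x = (\<Sum>i<n. f i)))"


definition frob_form :: "('k, 'a) alg \<Rightarrow> ('a \<Rightarrow> 'k) \<Rightarrow> 'a \<Rightarrow> 'a \<Rightarrow> 'k" where
  "frob_form C l x y = l (alg_mult C x y)"

locale frobenius_pair = fd_algebra C
  for C :: "('k::field, 'a::ab_group_add) alg" +
  fixes l :: "'a \<Rightarrow> 'k"
  assumes functional_add: "\<lbrakk>x \<in> alg_space C; y \<in> alg_space C\<rbrakk> \<Longrightarrow> l (x + y) = l x + l y"
    and functional_scale: "x \<in> alg_space C \<Longrightarrow> l (alg_scale C c x) = c * l x"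
    and form_sym: "\<lbrakk>x \<in> alg_space C; y \<in> alg_space C\<rbrakk> \<Longrightarrow> frob_form C l x y = frob_form C l y x"
    and form_nondegenerate:
      "\<lbrakk>x \<in> alg_space C; \<forall>y\<in>alg_space C. frob_form C l x y = 0\<rbrakk> \<Longrightarrow> x = 0"

text \<open>
  The dual map is well defined on the space of \<open>B\<close> whenever \<open>(A, lA)\<close> is a Frobenius pair.
\<close>

definition dual_map ::
  "('k, 'a) alg \<Rightarrow> ('a \<Rightarrow> 'k) \<Rightarrow> ('k, 'b) alg \<Rightarrow> ('b \<Rightarrow> 'k) \<Rightarrow> ('a \<Rightarrow> 'b) \<Rightarrow> 'b \<Rightarrow> 'a" where
  "dual_map A lA B lB \<phi> b =
     (THE x. x \<in> alg_space A \<and>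
        (\<forall>a\<in>alg_space A. frob_form A lA x a = frob_form B lB b (\<phi> a)))"

fun cardy_frobenius_algebra ::
  "(('k::field, 'a::ab_group_add) alg \<times> ('a \<Rightarrow> 'k)) \<times>
   (('k, 'b::ab_group_add) alg \<times> ('b \<Rightarrow> 'k)) \<times> ('a \<Rightarrow> 'b) \<Rightarrow> bool" where
  "cardy_frobenius_algebra ((A, lA), (B, lB), \<phi>) \<longleftrightarrow>
     frobenius_pair A lA \<and> alg_commutative A \<and>
     frobenius_pair B lB \<and>
     alg_hom A B \<phi> \<and> \<phi> ` alg_space A \<subseteq> alg_center B \<and>
     (\<forall>b'\<in>alg_space B. \<forall>b''\<in>alg_space B.
        frob_form A lA (dual_map A lA B lB \<phi> b') (dual_map A lA B lB \<phi> b'') =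
        vector_space.trace_on (alg_scale B) (alg_space B)
          (\<lambda>b. alg_mult B (alg_mult B b' b) b''))"

fun semisimple_cardy_frobenius_algebra ::
  "(('k::field, 'a::ab_group_add) alg \<times> ('a \<Rightarrow> 'k)) \<times>
   (('k, 'b::ab_group_add) alg \<times> ('b \<Rightarrow> 'k)) \<times> ('a \<Rightarrow> 'b) \<Rightarrow> bool" where
  "semisimple_cardy_frobenius_algebra ((A, lA), (B, lB), \<phi>) \<longleftrightarrow>
     cardy_frobenius_algebra ((A, lA), (B, lB), \<phi>) \<and> semisimple_alg A \<and> semisimple_alg B"


text \<open>
  Elements of the group algebra are coefficient functions vanishing outside \<open>carrier G\<close>;
  the product is convolution.
\<close>

definition group_algebra :: "('g, 'm) monoid_scheme \<Rightarrow> ('k::field, 'g \<Rightarrow> 'k) alg" where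
  "group_algebra G =
     \<lparr>alg_scale = (\<lambda>c x g. c * x g),
      alg_space = {x. \<forall>g. g \<notin> carrier G \<longrightarrow> x g = 0},
      alg_mult = (\<lambda>x y g. if g \<in> carrier G
        then \<Sum>h\<in>carrier G. x h * y (inv\<^bsub>G\<^esub> h \<otimes>\<^bsub>G\<^esub> g) else 0),
      alg_one = (\<lambda>g. if g = \<one>\<^bsub>G\<^esub> then 1 else 0)\<rparr>"

locale fd_representation = group G + vector_space scale
  for G :: "('g, 'm) monoid_scheme" (structure)
    and scale :: "'k::field \<Rightarrow> 'v::ab_group_add \<Rightarrow> 'v" +
  fixes \<rho> :: "'g \<Rightarrow> 'v \<Rightarrow> 'v"
  assumes finite_dim: "\<exists>F. finite F \<and> span F = UNIV"
    and linear_rep: "g \<in> carrier G \<Longrightarrow> Vector_Spaces.linear scale scale (\<rho> g)"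
    and rep_one: "\<rho> \<one> = id"
    and rep_mult: "\<lbrakk>g \<in> carrier G; h \<in> carrier G\<rbrakk> \<Longrightarrow> \<rho> (g \<otimes> h) = \<rho> g \<circ> \<rho> h"

definition group_algebra_action ::
  "('g, 'm) monoid_scheme \<Rightarrow> ('k \<Rightarrow> 'v::ab_group_add \<Rightarrow> 'v) \<Rightarrow> ('g \<Rightarrow> 'v \<Rightarrow> 'v) \<Rightarrow>
   ('g \<Rightarrow> 'k) \<Rightarrow> 'v \<Rightarrow> 'v" where
  "group_algebra_action G scale \<rho> x v = (\<Sum>g\<in>carrier G. scale (x g) (\<rho> g v))"

definition intertwiner_algebra ::
  "('g, 'm) monoid_scheme \<Rightarrow> ('k::field \<Rightarrow> 'v::ab_group_add \<Rightarrow> 'v) \<Rightarrow> ('g \<Rightarrow> 'v \<Rightarrow> 'v) \<Rightarrow>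
   ('k, 'v \<Rightarrow> 'v) alg" where
  "intertwiner_algebra G scale \<rho> =
     \<lparr>alg_scale = (\<lambda>c f v. scale c (f v)),
      alg_space = {f. Vector_Spaces.linear scale scale f \<and> (\<forall>g\<in>carrier G. f \<circ> \<rho> g = \<rho> g \<circ> f)},
      alg_mult = (\<circ>),
      alg_one = id\<rparr>"

definition center_functional ::
  "('g, 'm) monoid_scheme \<Rightarrow> ('g \<Rightarrow> 'k::field) \<Rightarrow> ('g \<Rightarrow> 'k) \<Rightarrow> 'k" where
  "center_functional G \<mu> x =
     (let KG = group_algebra G
      in alg_scale KG (1 / of_nat (card (carrier G))) (alg_mult KG (alg_mult KG \<mu> \<mu>) x) \<one>\<^bsub>G\<^esub>)"

definition intertwiner_functional ::
  "('g, 'm) monoid_scheme \<Rightarrow> ('k::field \<Rightarrow> 'v::ab_group_add \<Rightarrow> 'v) \<Rightarrow> ('g \<Rightarrow> 'v \<Rightarrow> 'v) \<Rightarrow>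
   ('g \<Rightarrow> 'k) \<Rightarrow> ('v \<Rightarrow> 'v) \<Rightarrow> 'k" where
  "intertwiner_functional G scale \<rho> \<mu> x =
     vector_space.trace_on scale UNIV
       (\<lambda>v. scale (1 / of_nat (card (carrier G))) (group_algebra_action G scale \<rho> \<mu> (x v)))"

definition H_algebra ::
  "('g, 'm) monoid_scheme \<Rightarrow> ('k::field \<Rightarrow> 'v::ab_group_add \<Rightarrow> 'v) \<Rightarrow> ('g \<Rightarrow> 'v \<Rightarrow> 'v) \<Rightarrow>
   ('g \<Rightarrow> 'k) \<Rightarrow>
   (('k, 'g \<Rightarrow> 'k) alg \<times> (('g \<Rightarrow> 'k) \<Rightarrow> 'k)) \<times>
   (('k, 'v \<Rightarrow> 'v) alg \<times> (('v \<Rightarrow> 'v) \<Rightarrow> 'k)) \<times> (('g \<Rightarrow> 'k) \<Rightarrow> 'v \<Rightarrow> 'v)" where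
  "H_algebra G scale \<rho> \<mu> =
     ((center_algebra (group_algebra G), center_functional G \<mu>),
      (intertwiner_algebra G scale \<rho>, intertwiner_functional G scale \<rho> \<mu>),
      group_algebra_action G scale \<rho>)"

end

theory Submission
  imports Defs
begin

text \<open>
  Everything rests on averaging over the group and on one formula for traces, which both work over
  an arbitrary field in which \<open>|G|\<close> is invertible.

  \<^bold>\<open>Frobenius pairs.\<close> The form of \<open>A\<close> is, up to the invertible factor \<open>\<mu>\<^sup>2/|G|\<close>, the coefficient of
  \<open>x y\<close> at the unit. A central \<open>x\<close> is tested against the sum of all conjugates of \<open>g\<^sup>-\<^sup>1\<close>, which
  yields \<open>|G|\<close> times the coefficient of \<open>x\<close> at \<open>g\<close>. The form of \<open>B\<close> is, up to \<open>\<mu>/|G|\<close>, the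
  trace form \<open>Tr (x y)\<close>, which is non-degenerate on all operators. As the trace is invariant under
  conjugation, averaging the second argument shows that it stays non-degenerate on intertwining
  operators.

  \<^bold>\<open>Semi-simplicity.\<close> A Frobenius pair whose functional vanishes on all \<open>x\<close> with \<open>x x = 0\<close> is
  semi-simple (\<open>semisimple_if_kills_square_zero\<close>): a minimal left ideal \<open>M\<close> with \<open>M M = 0\<close> would lie
  in the radical of the form, so each one contains a right unit \<open>e\<close>, which splits it off from any
  left ideal around it. The criterion holds for \<open>B\<close> because square-zero operators have trace zero,
  and for \<open>A\<close> because \<open>|G|\<close> times the coefficient at the unit is the trace in the regular
  representation.

  \<^bold>\<open>Cardy condition.\<close> Put \<open>T b = \<Sum>\<^sub>g Tr (\<rho> (inv g) \<circ> b) g\<close>. Then \<open>T b\<close> is central and \<open>(T b a)(1)\<close>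
  is the trace of \<open>a\<close> acting after \<open>b\<close>; hence the dual map is \<open>b \<mapsto> \<mu>\<^sup>-\<^sup>1 T b\<close>
  (\<open>dual_map_character_sum\<close>). The powers of \<open>\<mu>\<close> cancel on the left-hand side, which becomes
  \<open>(\<Sum>\<^sub>g Tr (\<rho> g \<circ> b') * Tr (\<rho> (inv g) \<circ> b''))/|G|\<close>. The same sum is the trace of \<open>x \<mapsto> b' x b''\<close> on
  \<open>B\<close>: the averaging projection onto \<open>B\<close> reduces it to the traces of \<open>x \<mapsto> \<rho> g b' x b'' \<rho> (inv g)\<close> on
  all operators, which are products of two traces (\<open>trace_two_sided_multiplication\<close>).
\<close>

section \<open>Traces of operators of finite rank\<close>

context vector_space
begin

lemma functional_on_sum:
  assumes S: "subspace S" and "finite I" and v: "\<And>i. i \<in> I \<Longrightarrow> v i \<in> S"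
    and add: "\<And>x y. x \<in> S \<Longrightarrow> y \<in> S \<Longrightarrow> c (x + y) = c x + (c y :: 'a)"
    and scale: "\<And>k x. x \<in> S \<Longrightarrow> c (k *s x) = k * c x"
  shows "c (\<Sum>i\<in>I. r i *s v i) = (\<Sum>i\<in>I. r i * c (v i))"
  using \<open>finite I\<close> v
proof (induction I rule: finite_induct)
  case empty
  show ?case using scale[of 0 0] subspace_0[OF S] by simp
next
  case (insert i I)
  then show ?case
    by (simp add: add scale subspace_scale[OF S] subspace_sum[OF S])
qed

lemma subspace_basis:
  assumes "subspace S" "finite F" "S \<subseteq> span F"
  obtains E where "finite E" "independent E" "span E = S"
proof -
  obtain E where E: "E \<subseteq> S" "independent E" "S \<subseteq> span E"
    using maximal_independent_subset[of S] by blast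
  then have "span E = S" using assms(1) by (intro span_subspace)
  moreover have "finite E" using independent_span_bound[OF assms(2) E(2)] E(1) assms(3) by blast
  ultimately show ?thesis using E that by blast
qed

text \<open>
  The trace is the contraction \<open>S\<^sup>* \<otimes> S \<rightarrow> K\<close>: an operator written as
  \<open>\<Sum> c\<^sub>i \<otimes> u\<^sub>i\<close> has trace \<open>\<Sum> c\<^sub>i(u\<^sub>i)\<close>. As the \<open>u\<^sub>i\<close> are an
  arbitrary finite family, this one formula yields independence of the basis, the cyclic property,
  the vanishing of the trace on square-zero operators and the trace of an operator on an operator space.
\<close>

lemma trace_on_eq_sum:
  assumes S: "subspace S" and F: "finite F" "S \<subseteq> span F" and I: "finite I"
    and u: "\<And>i. i \<in> I \<Longrightarrow> u i \<in> S"
    and add: "\<And>i x y. i \<in> I \<Longrightarrow> x \<in> S \<Longrightarrow> y \<in> S \<Longrightarrow> c i (x + y) = c i x + c i y"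
    and scale: "\<And>i k x. i \<in> I \<Longrightarrow> x \<in> S \<Longrightarrow> c i (k *s x) = k * c i x"
    and f: "\<And>x. x \<in> S \<Longrightarrow> f x = (\<Sum>i\<in>I. c i x *s u i)"
  shows "trace_on S f = (\<Sum>i\<in>I. c i (u i))"
proof -
  define E where "E = (SOME E. independent E \<and> span E = S)"
  have "\<exists>E. independent E \<and> span E = S"
    using subspace_basis[OF S F] by blast
  then have E: "independent E" "span E = S"
    unfolding E_def by (metis (mono_tags, lifting) someI_ex)+
  have sub: "E \<subseteq> S" using E span_superset by blast
  have fin: "finite E" using independent_span_bound[OF F(1) E(1)] sub F(2) by blast
  have "trace_on S f = (\<Sum>e\<in>E. representation E (f e) e)"
    by (simp add: trace_on_def E_def Let_def)
  also have "\<dots> = (\<Sum>e\<in>E. \<Sum>i\<in>I. representation E (u i) e * c i e)"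
  proof (rule sum.cong[OF refl])
    fix e assume "e \<in> E"
    then have "e \<in> S" using sub by blast
    have "representation E (f e) e = (\<Sum>i\<in>I. representation E (c i e *s u i) e)"
      using E u by (simp add: f[OF \<open>e \<in> S\<close>] representation_sum subspace_scale[OF S])
    then show "representation E (f e) e = (\<Sum>i\<in>I. representation E (u i) e * c i e)"
      using E u by (simp add: representation_scale mult.commute)
  qed
  also have "\<dots> = (\<Sum>i\<in>I. \<Sum>e\<in>E. representation E (u i) e * c i e)"
    by (rule sum.swap)
  also have "\<dots> = (\<Sum>i\<in>I. c i (\<Sum>e\<in>E. representation E (u i) e *s e))"
    using sub by (intro sum.cong[OF refl] functional_on_sum[symmetric, OF S fin])
      (auto simp: add scale)
  also have "\<dots> = (\<Sum>i\<in>I. c i (u i))"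
    using E u fin by (intro sum.cong[OF refl] arg_cong2[of _ _ _ _ c]) 
      (simp_all add: sum_representation_eq)
  finally show ?thesis .
qed

text \<open>
  Expanding \<open>f x\<close> in a basis of the image of \<open>f\<close> turns the trace into a sum of coordinates of
  \<open>f d\<close> with \<open>d\<close> in the image, and all these vectors are zero.
\<close>

lemma trace_on_square_zero:
  assumes S: "subspace S" and F: "finite F" "S \<subseteq> span F"
    and add: "\<And>x y. x \<in> S \<Longrightarrow> y \<in> S \<Longrightarrow> f (x + y) = f x + f y"
    and scale: "\<And>k x. x \<in> S \<Longrightarrow> f (k *s x) = k *s f x"
    and closed: "\<And>x. x \<in> S \<Longrightarrow> f x \<in> S"
    and sq: "\<And>x. x \<in> S \<Longrightarrow> f (f x) = 0"
  shows "trace_on S f = 0"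
proof -
  have f0: "f 0 = 0" using scale[of 0 0] subspace_0[OF S] by simp
  have T: "subspace (f ` S)"
  proof (rule subspaceI)
    show "0 \<in> f ` S" using f0 subspace_0[OF S] by (metis imageI)
    show "x + y \<in> f ` S" if "x \<in> f ` S" "y \<in> f ` S" for x y
      using that subspace_add[OF S] by (auto simp flip: add)
    show "k *s x \<in> f ` S" if "x \<in> f ` S" for k x
      using that subspace_scale[OF S] by (auto simp flip: scale)
  qed
  have "f ` S \<subseteq> span F" using closed F(2) by blast
  then obtain D where D: "finite D" "independent D" "span D = f ` S"
    using subspace_basis[OF T F(1)] by blast
  have dT: "d \<in> f ` S" if "d \<in> D" for d
    using that D(3) span_base by blast
  have "trace_on S f = (\<Sum>d\<in>D. representation D (f d) d)"
  proof (rule trace_on_eq_sum[OF S F D(1), of "\<lambda>d. d" "\<lambda>d x. representation D (f x) d"])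
    show "f x = (\<Sum>d\<in>D. representation D (f x) d *s d)" if "x \<in> S" for x
      using that D by (intro sum_representation_eq[symmetric]) auto
    show "d \<in> S" if "d \<in> D" for d using dT[OF that] closed by blast
  qed (auto simp: add scale D representation_add representation_scale)
  also have "\<dots> = (\<Sum>d\<in>D. representation D 0 d)"
  proof (rule sum.cong[OF refl])
    fix d assume "d \<in> D"
    then have "f d = 0" using dT sq by blast
    then show "representation D (f d) d = representation D 0 d" by simp
  qed
  finally show ?thesis by (simp add: representation_zero)
qed

context
  fixes E
  assumes finE: "finite E" and indE: "independent E" and spanE: "span E = UNIV"
begin

lemma linear_basis_expansion:
  assumes "Vector_Spaces.linear scale scale f"
  shows "f x = (\<Sum>e\<in>E. representation E x e *s f e)"
proof -
  interpret f: Vector_Spaces.linear scale scale f by fact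
  have "f x = f (\<Sum>e\<in>E. representation E x e *s e)"
    using finE indE spanE by (simp add: sum_representation_eq)
  then show ?thesis by (simp add: f.sum f.scale)
qed

lemma trace_basis:
  assumes "Vector_Spaces.linear scale scale f"
  shows "trace_on UNIV f = (\<Sum>e\<in>E. representation E (f e) e)"
proof -
  interpret f: Vector_Spaces.linear scale scale f by fact
  show ?thesis
  proof (rule trace_on_eq_sum[OF subspace_UNIV finE _ finE,
        where c = "\<lambda>e x. representation E (f x) e" and u = "\<lambda>e. e"])
    show "f x = (\<Sum>e\<in>E. representation E (f x) e *s e)" for x
      using finE indE spanE by (simp add: sum_representation_eq)
  qed (use indE spanE in \<open>auto simp: f.add f.scale representation_add representation_scale\<close>)
qed

lemma trace_comp_commute:
  assumes f: "Vector_Spaces.linear scale scale f" and g: "Vector_Spaces.linear scale scale g"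
  shows "trace_on UNIV (f \<circ> g) = trace_on UNIV (g \<circ> f)"
proof -
  interpret g: Vector_Spaces.linear scale scale g by fact
  have "trace_on UNIV (f \<circ> g) = (\<Sum>e\<in>E. representation E (g (f e)) e)"
  proof (rule trace_on_eq_sum[OF subspace_UNIV finE _ finE,
        where c = "\<lambda>e x. representation E (g x) e" and u = f])
    show "(f \<circ> g) x = (\<Sum>e\<in>E. representation E (g x) e *s f e)" for x
      by (simp only: comp_apply linear_basis_expansion[OF f, of "g x"])
  qed (use indE spanE in \<open>auto simp: g.add g.scale representation_add representation_scale\<close>)
  also have "\<dots> = trace_on UNIV (g \<circ> f)"
    using trace_basis[OF Vector_Spaces.linear_compose[OF f g]] by simp
  finally show ?thesis .
qed

end

end

section \<open>Frobenius pairs whose functional kills square-zero elements\<close>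

context fd_algebra
begin

lemma mult_zero_left [simp]: "x \<in> alg_space A \<Longrightarrow> alg_mult A 0 x = 0"
  using scale_mult_left[of 0 x 0] subspace_0[OF subspace_space] by simp

lemma mult_zero_right [simp]: "x \<in> alg_space A \<Longrightarrow> alg_mult A x 0 = 0"
  using scale_mult_right[of x 0 0] subspace_0[OF subspace_space] by simp

lemma mult_diff_left:
  assumes "x \<in> alg_space A" "y \<in> alg_space A" "z \<in> alg_space A"
  shows "alg_mult A (x - y) z = alg_mult A x z - alg_mult A y z"
  using distrib_right[of "x - y" y z] assms subspace_diff[OF subspace_space] by simp

lemma mult_sum_left:
  assumes "finite I" "\<And>i. i \<in> I \<Longrightarrow> f i \<in> alg_space A" "z \<in> alg_space A"
  shows "alg_mult A (\<Sum>i\<in>I. f i) z = (\<Sum>i\<in>I. alg_mult A (f i) z)"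
  using assms by (induction I rule: finite_induct)
    (simp_all add: distrib_right subspace_sum[OF subspace_space])

lemma left_idealD:
  assumes "left_ideal A I"
  shows "subspace I" "\<And>x. x \<in> I \<Longrightarrow> x \<in> alg_space A"
    "\<And>a x. a \<in> alg_space A \<Longrightarrow> x \<in> I \<Longrightarrow> alg_mult A a x \<in> I"
  using assms by (auto simp: left_ideal_def)

text \<open>
  This and the image of \<open>I\<close> under right multiplication are the kernel and the image of a
  homomorphism of left modules; minimality of an ideal is always tested against these two.
\<close>

lemma left_ideal_annihilator:
  assumes I: "left_ideal A I" and e: "e \<in> alg_space A"
  shows "left_ideal A {x \<in> I. alg_mult A x e = 0}"
proof -
  note D = left_idealD[OF I]
  have "subspace {x \<in> I. alg_mult A x e = 0}"
    by (rule subspaceI)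
      (use e D in \<open>auto simp: subspace_0 subspace_add subspace_scale distrib_right scale_mult_left\<close>)
  then show ?thesis
    using D e by (auto simp: left_ideal_def mult_assoc)
qed

lemma left_ideal_image:
  assumes I: "left_ideal A I" and x: "x \<in> alg_space A"
  shows "left_ideal A ((\<lambda>y. alg_mult A y x) ` I)"
proof -
  note D = left_idealD[OF I]
  have "subspace ((\<lambda>y. alg_mult A y x) ` I)"
  proof (rule subspaceI)
    show "0 \<in> (\<lambda>y. alg_mult A y x) ` I"
      using x D(1) by (intro image_eqI[of _ _ 0]) (simp_all add: subspace_0)
    show "p + q \<in> (\<lambda>y. alg_mult A y x) ` I"
      if "p \<in> (\<lambda>y. alg_mult A y x) ` I" "q \<in> (\<lambda>y. alg_mult A y x) ` I" for p q
      using that x D by (auto simp: subspace_add simp flip: distrib_right)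
    show "alg_scale A k p \<in> (\<lambda>y. alg_mult A y x) ` I"
      if "p \<in> (\<lambda>y. alg_mult A y x) ` I" for k p
      using that x D by (auto simp: subspace_scale simp flip: scale_mult_left)
  qed
  moreover have "alg_mult A a (alg_mult A y x) \<in> (\<lambda>y. alg_mult A y x) ` I"
    if "a \<in> alg_space A" "y \<in> I" for a y
    using that x D by (intro image_eqI[of _ _ "alg_mult A a y"]) (simp_all add: mult_assoc)
  ultimately show ?thesis
    using D x by (auto simp: left_ideal_def mult_closed)
qed

lemma dim_psubset_left_ideal:
  assumes J: "left_ideal A J" and I: "left_ideal A I" and "J \<subset> I"
  shows "dim J < dim I"
proof -
  obtain F where F: "finite F" "span F = alg_space A" using finite_dim by blast
  obtain D where D: "finite D" "independent D" "span D = J"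
    using subspace_basis[OF _ F(1), of J] left_idealD[OF J] F(2) by blast
  have "D \<subseteq> I" using D(3) span_superset \<open>J \<subset> I\<close> by blast
  then obtain E where E: "D \<subseteq> E" "E \<subseteq> I" "independent E" "I \<subseteq> span E"
    using maximal_independent_subset_extend[OF _ D(2)] by metis
  have "finite E"
    using independent_span_bound[OF F(1) E(3)] E(2) F(2) left_idealD(2)[OF I] by blast
  moreover have "D \<noteq> E" using D(3) E(4) \<open>J \<subset> I\<close> by blast
  ultimately have "card D < card E" using E(1) by (simp add: psubsetI psubset_card_mono)
  then show ?thesis
    using D basis_card_eq_dim[OF E(2,4,3)] dim_span_eq_card_independent[OF D(2)] by simp
qed

lemma minimal_left_ideal_below:
  assumes "left_ideal A I" "I \<noteq> {0}"
  obtains J where "minimal_left_ideal A J" "J \<subseteq> I"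
proof -
  have "\<exists>J. minimal_left_ideal A J \<and> J \<subseteq> I"
    using assms
  proof (induction "dim I" arbitrary: I rule: less_induct)
    case less
    show ?case
    proof (cases "minimal_left_ideal A I")
      case False
      then obtain J where "left_ideal A J" "J \<subset> I" "J \<noteq> {0}"
        using less.prems by (auto simp: minimal_left_ideal_def)
      then show ?thesis
        using less.hyps[of J] dim_psubset_left_ideal[of J I] less.prems by blast
    qed auto
  qed
  then show ?thesis using that by blast
qed

end

context frobenius_pair
begin

text \<open>
  The argument is that of Brauer's lemma. If \<open>I I = 0\<close>, then every \<open>y x\<close> with \<open>x \<in> I\<close> has
  square zero, so \<open>x\<close> lies in the radical of the form and \<open>I = 0\<close>. Otherwise \<open>I x \<noteq> 0\<close> for some
  \<open>x \<in> I\<close>; by minimality right multiplication by \<open>x\<close> is a bijection of \<open>I\<close>, and the preimage \<open>e\<close> of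
  \<open>x\<close> is a right unit, since \<open>y e - y\<close> is annihilated by \<open>x\<close>.
\<close>

lemma minimal_left_ideal_unit:
  assumes sq: "\<And>x. x \<in> alg_space C \<Longrightarrow> alg_mult C x x = 0 \<Longrightarrow> l x = 0"
    and I: "minimal_left_ideal C I"
  obtains e where "e \<in> I" "\<And>y. y \<in> I \<Longrightarrow> alg_mult C y e = y"
proof -
  have L: "left_ideal C I" and "I \<noteq> {0}" using I by (auto simp: minimal_left_ideal_def)
  have min: "J = {0} \<or> J = I" if "left_ideal C J" "J \<subseteq> I" for J
    using I that by (auto simp: minimal_left_ideal_def)
  note D = left_idealD[OF L]
  \<comment> \<open>The form is symmetric, so it suffices that \<open>l\<close> vanishes on \<open>y x\<close>, which stays in the left ideal.\<close>
  have "\<exists>x\<in>I. \<exists>y\<in>I. alg_mult C y x \<noteq> 0"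
  proof (rule ccontr)
    assume "\<not> ?thesis"
    then have zero: "alg_mult C y x = 0" if "x \<in> I" "y \<in> I" for x y using that by blast
    have "x = 0" if x: "x \<in> I" for x
    proof (rule form_nondegenerate)
      show "\<forall>y\<in>alg_space C. frob_form C l x y = 0"
      proof
        fix y assume y: "y \<in> alg_space C"
        have "alg_mult C y x \<in> I" using D y x by blast
        then have "l (alg_mult C y x) = 0" using zero D(2) by (intro sq) auto
        then show "frob_form C l x y = 0"
          using form_sym[of x y] x y D(2) by (simp add: frob_form_def)
      qed
    qed (use x D in blast)
    then show False using \<open>I \<noteq> {0}\<close> subspace_0[OF D(1)] by blast
  qed
  then obtain x y0 where x: "x \<in> I" and y0: "y0 \<in> I" "alg_mult C y0 x \<noteq> 0" by blast
  have xC: "x \<in> alg_space C" using D x by blast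
  have "(\<lambda>y. alg_mult C y x) ` I = I"
    using min[OF left_ideal_image[OF L xC]] D x y0 by auto
  then obtain e where e: "e \<in> I" "alg_mult C e x = x" using x by (metis imageE)
  have ann: "{y \<in> I. alg_mult C y x = 0} = {0}"
    using min[OF left_ideal_annihilator[OF L xC]] y0 by blast
  have "alg_mult C y e = y" if y: "y \<in> I" for y
  proof -
    have "alg_mult C (alg_mult C y e - y) x = 0"
      using y e D xC by (simp add: mult_diff_left mult_closed mult_assoc)
    moreover have "alg_mult C y e - y \<in> I"
      using y e D by (simp add: subspace_diff)
    ultimately have "alg_mult C y e - y = 0" using ann by blast
    then show ?thesis by simp
  qed
  then show ?thesis using e that by blast
qed

text \<open>
  A right unit \<open>e\<close> of a minimal left ideal \<open>M \<subseteq> I\<close> splits \<open>I\<close> by the Peirce decomposition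
  \<open>I = M \<oplus> {x \<in> I. x e = 0}\<close>, and the second summand has smaller dimension.
\<close>

lemma left_ideal_direct_sum:
  assumes sq: "\<And>x. x \<in> alg_space C \<Longrightarrow> alg_mult C x x = 0 \<Longrightarrow> l x = 0"
    and I: "left_ideal C I"
  shows "\<exists>(n::nat) L. (\<forall>i<n. minimal_left_ideal C (L i) \<and> L i \<subseteq> I) \<and>
           (\<forall>x\<in>I. \<exists>!f. f \<in> (\<Pi>\<^sub>E i\<in>{..<n}. L i) \<and> x = (\<Sum>i<n. f i))"
  using I
proof (induction "dim I" arbitrary: I rule: less_induct)
  case less
  note D = left_idealD[OF less.prems]
  show ?case
  proof (cases "I = {0}")
    case True
    then show ?thesis by (intro exI[of _ 0]) auto
  next
    case False
    obtain M where M: "minimal_left_ideal C M" "M \<subseteq> I"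
      using minimal_left_ideal_below[OF less.prems False] .
    obtain e where e: "e \<in> M" "\<And>y. y \<in> M \<Longrightarrow> alg_mult C y e = y"
      using minimal_left_ideal_unit[OF sq M(1)] by blast
    have LM: "left_ideal C M" and "M \<noteq> {0}" using M by (auto simp: minimal_left_ideal_def)
    note DM = left_idealD[OF LM]
    have eC: "e \<in> alg_space C" using e DM by blast
    define J where "J = {x \<in> I. alg_mult C x e = 0}"
    have J: "left_ideal C J" unfolding J_def by (rule left_ideal_annihilator[OF less.prems eC])
    note DJ = left_idealD[OF J]
    have "e \<noteq> 0"
    proof
      assume "e = 0"
      then have "M \<subseteq> {0}" using e(2) DM(2) by force
      then show False using \<open>M \<noteq> {0}\<close> subspace_0[OF DM(1)] by blast
    qed
    then have "e \<notin> J" using e by (auto simp: J_def)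
    moreover have "J \<subseteq> I" by (auto simp: J_def)
    ultimately have "J \<subset> I" using e(1) M(2) by blast
    then obtain n :: nat and L where L: "\<And>i. i < n \<Longrightarrow> minimal_left_ideal C (L i)" "\<And>i. i < n \<Longrightarrow> L i \<subseteq> J"
      and ex1: "\<And>x. x \<in> J \<Longrightarrow> \<exists>!f. f \<in> (\<Pi>\<^sub>E i\<in>{..<n}. L i) \<and> x = (\<Sum>i<n. f i)"
      using less.hyps[OF dim_psubset_left_ideal[OF J less.prems] J] by metis
    define L' where "L' = L(n := M)"
    have sums: "\<exists>!f. f \<in> (\<Pi>\<^sub>E i\<in>{..<Suc n}. L' i) \<and> x = (\<Sum>i<Suc n. f i)"
      if x: "x \<in> I" for x
    proof -
      have xC: "x \<in> alg_space C" using x D by blast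
      have xe: "alg_mult C x e \<in> M" using xC DM(3) e by blast
      have xJ: "x - alg_mult C x e \<in> J"
        using x xC xe eC e M(2) D DM
        by (auto simp: J_def subspace_diff mult_diff_left mult_closed)
      \<comment> \<open>Multiplication by \<open>e\<close> kills the components in \<open>J\<close> and fixes the one in \<open>M\<close>, so the
        component in \<open>M\<close> can only be \<open>x e\<close>.\<close>
      have uniq: "f n = alg_mult C x e \<and> restrict f {..<n} \<in> (\<Pi>\<^sub>E i\<in>{..<n}. L i) \<and>
                   x - alg_mult C x e = (\<Sum>i<n. restrict f {..<n} i)"
        if f: "f \<in> (\<Pi>\<^sub>E i\<in>{..<Suc n}. L' i)" "x = (\<Sum>i<Suc n. f i)" for f
      proof -
        have fn: "f n \<in> M" using f(1) by (force simp: L'_def PiE_def Pi_def)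
        have fi: "f i \<in> L i" if "i < n" for i
          using PiE_mem[OF f(1), of i] that by (simp add: L'_def)
        have fJ: "f i \<in> J" if "i < n" for i using fi L(2) that by blast
        have "alg_mult C (\<Sum>i<n. f i) e = (\<Sum>i<n. alg_mult C (f i) e)"
          using fJ DJ eC by (intro mult_sum_left) auto
        also have "\<dots> = 0" using fJ by (intro sum.neutral) (auto simp: J_def)
        finally have "alg_mult C (\<Sum>i<n. f i) e = 0" .
        moreover have "(\<Sum>i<n. f i) \<in> alg_space C"
          using fJ DJ by (intro subspace_sum[OF subspace_space]) auto
        ultimately have "alg_mult C x e = f n"
          using f(2) fn DM(2) e eC by (simp add: distrib_right)
        then show ?thesis using f(2) fi by (auto simp: restrict_def PiE_def extensional_def)
      qed
      from ex1[OF xJ] obtain g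
        where g: "g \<in> (\<Pi>\<^sub>E i\<in>{..<n}. L i)" "x - alg_mult C x e = (\<Sum>i<n. g i)"
          and "\<forall>h. h \<in> (\<Pi>\<^sub>E i\<in>{..<n}. L i) \<and> x - alg_mult C x e = (\<Sum>i<n. h i) \<longrightarrow> h = g"
        unfolding Ex1_def by (elim exE conjE)
      then have g_unique: "h = g"
        if "h \<in> (\<Pi>\<^sub>E i\<in>{..<n}. L i)" "x - alg_mult C x e = (\<Sum>i<n. h i)" for h
        using that by simp
      define f where "f = g(n := alg_mult C x e)"
      show ?thesis
      proof (rule ex1I[of _ f])
        have "(\<Sum>i<n. f i) = (\<Sum>i<n. g i)" by (intro sum.cong) (auto simp: f_def)
        then have "x = (\<Sum>i<Suc n. f i)" using g(2) by (simp add: f_def algebra_simps)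
        moreover have "f \<in> (\<Pi>\<^sub>E i\<in>{..<Suc n}. L' i)"
          using g(1) xe by (auto simp: f_def L'_def PiE_def Pi_def extensional_def)
        ultimately show "f \<in> (\<Pi>\<^sub>E i\<in>{..<Suc n}. L' i) \<and> x = (\<Sum>i<Suc n. f i)" by blast
      next
        fix f' assume f': "f' \<in> (\<Pi>\<^sub>E i\<in>{..<Suc n}. L' i) \<and> x = (\<Sum>i<Suc n. f' i)"
        then have eq: "restrict f' {..<n} = g" using uniq g_unique by blast
        have "f' n = alg_mult C x e" using f' uniq by blast
        show "f' = f"
        proof
          fix i
          show "f' i = f i"
          proof (cases i n rule: linorder_cases)
            case less
            then show ?thesis using fun_cong[OF eq, of i] by (simp add: f_def)
          next
            case equal
            then show ?thesis using \<open>f' n = alg_mult C x e\<close> by (simp add: f_def)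
          next
            case greater
            then show ?thesis
              using f' g(1) by (auto simp: f_def PiE_def extensional_def)
          qed
        qed
      qed
    qed
    have mins: "minimal_left_ideal C (L' i) \<and> L' i \<subseteq> I" if "i < Suc n" for i
      using that L M by (cases "i = n") (auto simp: L'_def J_def less_Suc_eq)
    show ?thesis
    proof (rule exI[of _ "Suc n"], rule exI[of _ L'], rule conjI)
      show "\<forall>i<Suc n. minimal_left_ideal C (L' i) \<and> L' i \<subseteq> I"
        using mins by blast
      show "\<forall>x\<in>I. \<exists>!f. f \<in> (\<Pi>\<^sub>E i\<in>{..<Suc n}. L' i) \<and> x = (\<Sum>i<Suc n. f i)"
        by (rule ballI) (rule sums)
    qed
  qed
qed

text \<open>
  Both algebras of the main theorem meet this criterion, because up to a scalar factor their
  functionals send \<open>x\<close> to the trace of an operator \<open>m x\<close> with \<open>m\<close> commuting with \<open>x\<close>.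
\<close>

lemma semisimple_if_kills_square_zero:
  assumes "\<And>x. x \<in> alg_space C \<Longrightarrow> alg_mult C x x = 0 \<Longrightarrow> l x = 0"
  shows "semisimple_alg C"
proof -
  have "left_ideal C (alg_space C)"
    by (simp add: left_ideal_def subspace_space mult_closed)
  have "\<exists>(n::nat) L. (\<forall>i<n. minimal_left_ideal C (L i) \<and> L i \<subseteq> alg_space C) \<and>
      (\<forall>x\<in>alg_space C. \<exists>!f. f \<in> (\<Pi>\<^sub>E i\<in>{..<n}. L i) \<and> x = (\<Sum>i<n. f i))"
    by (rule left_ideal_direct_sum[OF _ \<open>left_ideal C (alg_space C)\<close>]) (fact assms)
  then obtain n :: nat and L
    where mins: "\<forall>i<n. minimal_left_ideal C (L i) \<and> L i \<subseteq> alg_space C"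
      and sums: "\<forall>x\<in>alg_space C. \<exists>!f. f \<in> (\<Pi>\<^sub>E i\<in>{..<n}. L i) \<and> x = (\<Sum>i<n. f i)"
    by (elim exE conjE)
  show ?thesis
    unfolding semisimple_alg_def
  proof (rule exI[of _ n], rule exI[of _ L], rule conjI)
    show "\<forall>i<n. minimal_left_ideal C (L i)" using mins by simp
  qed (rule sums)
qed

lemma dual_map_eqI:
  assumes x: "x \<in> alg_space C"
    and dual: "\<And>a. a \<in> alg_space C \<Longrightarrow> frob_form C l x a = frob_form B lB b (\<phi> a)"
  shows "dual_map C l B lB \<phi> b = x"
  unfolding dual_map_def
proof (rule the_equality)
  fix y assume y: "y \<in> alg_space C \<and> (\<forall>a\<in>alg_space C. frob_form C l y a = frob_form B lB b (\<phi> a))"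
  have "y - x = 0"
  proof (rule form_nondegenerate)
    show "y - x \<in> alg_space C" using x y by (simp add: subspace_diff[OF subspace_space])
    show "\<forall>a\<in>alg_space C. frob_form C l (y - x) a = 0"
    proof
      fix a assume a: "a \<in> alg_space C"
      have "frob_form C l y a = frob_form C l (y - x) a + frob_form C l x a"
        using a x y subspace_diff[OF subspace_space] functional_add mult_closed
        by (simp add: frob_form_def flip: distrib_right functional_add)
      then show "frob_form C l (y - x) a = 0" using a y dual by simp
    qed
  qed
  then show "y = x" by simp
qed (use assms in auto)

end


section \<open>The group algebra and its centre\<close>

context fd_algebra
begin

lemma subspace_center: "subspace (alg_center A)"
proof (rule subspaceI)
  show "0 \<in> alg_center A"
    by (simp add: alg_center_def subspace_0[OF subspace_space])
  show "x + y \<in> alg_center A" if "x \<in> alg_center A" "y \<in> alg_center A" for x y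
    using that by (simp add: alg_center_def subspace_add[OF subspace_space] distrib_left distrib_right)
  show "alg_scale A c x \<in> alg_center A" if "x \<in> alg_center A" for c x
    using that by (simp add: alg_center_def subspace_scale[OF subspace_space] scale_mult_left scale_mult_right)
qed

lemma center_mult_closed:
  assumes x: "x \<in> alg_center A" and y: "y \<in> alg_center A"
  shows "alg_mult A x y \<in> alg_center A"
proof -
  have xA: "x \<in> alg_space A" and yA: "y \<in> alg_space A"
    using x y by (auto simp: alg_center_def)
  have "alg_mult A (alg_mult A x y) z = alg_mult A z (alg_mult A x y)"
    if z: "z \<in> alg_space A" for z
  proof -
    have "alg_mult A x (alg_mult A y z) = alg_mult A x (alg_mult A z y)"
      using y z by (simp add: alg_center_def)
    also have "\<dots> = alg_mult A (alg_mult A x z) y"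
      using xA yA z by (simp add: mult_assoc)
    also have "\<dots> = alg_mult A (alg_mult A z x) y"
      using x z by (simp add: alg_center_def)
    finally show ?thesis using xA yA z by (simp add: mult_assoc)
  qed
  then show ?thesis using xA yA by (simp add: alg_center_def mult_closed)
qed

text \<open>
  Only finite-dimensionality needs an argument: the centre is a subspace of a finitely spanned
  space.
\<close>

lemma fd_algebra_center: "fd_algebra (center_algebra A)"
proof -
  obtain F where F: "finite F" "span F = alg_space A" using finite_dim by blast
  have sub: "x \<in> alg_space A" if "x \<in> alg_center A" for x
    using that by (simp add: alg_center_def)
  then have "alg_center A \<subseteq> span F" using F by blast
  then obtain E where E: "finite E" "span E = alg_center A"
    by (rule subspace_basis[OF subspace_center F(1)])
  have vs: "vector_space (alg_scale A)" by unfold_locales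
  have fin: "\<exists>F. finite F \<and> span F = alg_center A" using E by blast
  have one: "alg_one A \<in> alg_center A"
    by (simp add: alg_center_def one_closed one_left one_right)
  have simps: "alg_mult (center_algebra A) = alg_mult A" "alg_one (center_algebra A) = alg_one A"
    "alg_scale (center_algebra A) = alg_scale A" "alg_space (center_algebra A) = alg_center A"
    by (simp_all add: center_algebra_def)
  show ?thesis
    unfolding fd_algebra_def fd_algebra_axioms_def simps
    by (intro conjI allI impI vs subspace_center fin one center_mult_closed mult_assoc one_left
        one_right distrib_left distrib_right scale_mult_left scale_mult_right)
      (assumption | erule sub)+
qed

lemma commutative_center: "alg_commutative (center_algebra A)"
  unfolding alg_commutative_def
proof (intro ballI)
  fix x y assume x: "x \<in> alg_space (center_algebra A)" and y: "y \<in> alg_space (center_algebra A)"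
  have "\<forall>z\<in>alg_space A. alg_mult A x z = alg_mult A z x" and "y \<in> alg_space A"
    using x y by (simp_all add: center_algebra_def alg_center_def)
  then have "alg_mult A x y = alg_mult A y x" by (rule bspec)
  then show "alg_mult (center_algebra A) x y = alg_mult (center_algebra A) y x"
    by (simp add: center_algebra_def)
qed

end

lemma sum_fun_apply: "(\<Sum>i\<in>I. f i) x = (\<Sum>i\<in>I. f i x)"
  for f :: "'i \<Rightarrow> 'a \<Rightarrow> 'b::comm_monoid_add"
  by (induction I rule: infinite_finite_induct) auto

text \<open>
  The field enters through its type only; the last assumption says that its characteristic does
  not divide the group order.
\<close>

locale nonmodular_group = group G for G :: "('g, 'm) monoid_scheme" (structure) +
  fixes field_type :: "'k::field itself"
  assumes finite_group: "finite (carrier G)"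
    and order_nonzero: "(of_nat (card (carrier G)) :: 'k) \<noteq> 0"
begin

abbreviation KG :: "('k, 'g \<Rightarrow> 'k) alg" where "KG \<equiv> group_algebra G"

abbreviation conv :: "('g \<Rightarrow> 'k) \<Rightarrow> ('g \<Rightarrow> 'k) \<Rightarrow> 'g \<Rightarrow> 'k" (infixl "\<star>" 70)
  where "x \<star> y \<equiv> alg_mult KG x y"

abbreviation order_K :: 'k where "order_K \<equiv> of_nat (card (carrier G))"

definition point_mass :: "'g \<Rightarrow> 'g \<Rightarrow> 'k" where
  "point_mass h = (\<lambda>g. if g = h then 1 else 0)"

lemma sum_translate_left: "a \<in> carrier G \<Longrightarrow> (\<Sum>h\<in>carrier G. f (a \<otimes> h)) = sum f (carrier G)"
  by (rule sum.reindex_bij_witness[of _ "\<lambda>h. inv a \<otimes> h" "\<lambda>h. a \<otimes> h"])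
    (auto simp flip: m_assoc)

lemma sum_translate_right: "a \<in> carrier G \<Longrightarrow> (\<Sum>h\<in>carrier G. f (h \<otimes> a)) = sum f (carrier G)"
  by (rule sum.reindex_bij_witness[of _ "\<lambda>h. h \<otimes> inv a" "\<lambda>h. h \<otimes> a"]) (auto simp: m_assoc)

lemma sum_inverse: "(\<Sum>h\<in>carrier G. f (inv h)) = sum f (carrier G)"
  by (rule sum.reindex_bij_witness[of _ "\<lambda>h. inv h" "\<lambda>h. inv h"]) auto

lemma group_algebra_space: "x \<in> alg_space KG \<longleftrightarrow> (\<forall>g. g \<notin> carrier G \<longrightarrow> x g = 0)"
  by (simp add: group_algebra_def)

lemma group_algebra_scale: "alg_scale KG c x g = c * x g"
  by (simp add: group_algebra_def)

lemma group_algebra_one: "alg_one KG = point_mass \<one>"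
  by (simp add: group_algebra_def point_mass_def)

lemma conv_outside: "g \<notin> carrier G \<Longrightarrow> (x \<star> y) g = 0"
  by (simp add: group_algebra_def)

lemma conv_apply: "g \<in> carrier G \<Longrightarrow> (x \<star> y) g = (\<Sum>h\<in>carrier G. x h * y (inv h \<otimes> g))"
  by (simp add: group_algebra_def)

text \<open>
  Together with \<open>conv_apply\<close> this gives the two ways of summing over a factorization
  \<open>g = h k\<close>: by the left or by the right factor.
\<close>

lemma conv_apply':
  assumes g: "g \<in> carrier G"
  shows "(x \<star> y) g = (\<Sum>h\<in>carrier G. x (g \<otimes> inv h) * y h)"
proof -
  have "(x \<star> y) g = (\<Sum>h\<in>carrier G. x (inv h) * y (h \<otimes> g))"
    using g sum_inverse[of "\<lambda>h. x h * y (inv h \<otimes> g)"] by (simp add: conv_apply)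
  also have "\<dots> = (\<Sum>h\<in>carrier G. x (inv (h \<otimes> inv g)) * y (h \<otimes> inv g \<otimes> g))"
    using g sum_translate_right[of "inv g" "\<lambda>h. x (inv h) * y (h \<otimes> g)"] by simp
  also have "\<dots> = (\<Sum>h\<in>carrier G. x (g \<otimes> inv h) * y h)"
    using g by (intro sum.cong) (simp_all add: inv_mult_group m_assoc)
  finally show ?thesis .
qed

lemma conv_closed: "x \<star> y \<in> alg_space KG"
  by (simp add: group_algebra_space conv_outside)

lemma conv_assoc: "(x \<star> y) \<star> z = x \<star> (y \<star> z)"
proof
  fix g
  show "((x \<star> y) \<star> z) g = (x \<star> (y \<star> z)) g"
  proof (cases "g \<in> carrier G")
    case g: True
    have "((x \<star> y) \<star> z) g =
        (\<Sum>h\<in>carrier G. \<Sum>k\<in>carrier G. x k * y (inv k \<otimes> (g \<otimes> inv h)) * z h)"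
      by (subst conv_apply'[OF g]) (use g in \<open>simp add: conv_apply sum_distrib_right\<close>)
    also have "\<dots> = (\<Sum>k\<in>carrier G. \<Sum>h\<in>carrier G. x k * y (inv k \<otimes> (g \<otimes> inv h)) * z h)"
      by (rule sum.swap)
    also have "\<dots> = (x \<star> (y \<star> z)) g"
      by (subst conv_apply[OF g])
        (use g in \<open>simp add: conv_apply' sum_distrib_left mult.assoc m_assoc\<close>)
    finally show ?thesis .
  qed (simp add: conv_outside)
qed

lemma conv_point_mass_right:
  assumes "g \<in> carrier G" "h \<in> carrier G"
  shows "(x \<star> point_mass h) g = x (g \<otimes> inv h)"
proof -
  have "(x \<star> point_mass h) g = (\<Sum>k\<in>carrier G. if k = h then x (g \<otimes> inv k) else 0)"
    using assms by (subst conv_apply') (auto simp: point_mass_def intro!: sum.cong)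
  then show ?thesis using assms finite_group by simp
qed

lemma conv_point_mass_left:
  assumes "g \<in> carrier G" "h \<in> carrier G"
  shows "(point_mass h \<star> x) g = x (inv h \<otimes> g)"
proof -
  have "(point_mass h \<star> x) g = (\<Sum>k\<in>carrier G. if k = h then x (inv k \<otimes> g) else 0)"
    using assms by (subst conv_apply) (auto simp: point_mass_def intro!: sum.cong)
  then show ?thesis using assms finite_group by simp
qed

lemma point_mass_expansion:
  assumes "x \<in> alg_space KG"
  shows "x = (\<Sum>h\<in>carrier G. alg_scale KG (x h) (point_mass h))"
proof
  fix g
  have "(\<Sum>h\<in>carrier G. alg_scale KG (x h) (point_mass h)) g =
      (\<Sum>h\<in>carrier G. if h = g then x h else 0)"
    by (auto simp: sum_fun_apply group_algebra_scale point_mass_def intro!: sum.cong)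
  then show "x g = (\<Sum>h\<in>carrier G. alg_scale KG (x h) (point_mass h)) g"
    using assms finite_group by (auto simp: group_algebra_space)
qed

lemma vector_space_group_algebra: "vector_space (alg_scale KG)"
  by unfold_locales (auto simp: group_algebra_scale algebra_simps)

sublocale KG: fd_algebra "group_algebra G :: ('k, 'g \<Rightarrow> 'k) alg"
proof -
  interpret vector_space "alg_scale KG" by (rule vector_space_group_algebra)
  have sub: "subspace (alg_space KG)"
    by (rule subspaceI) (auto simp: group_algebra_space group_algebra_scale)
  have "span (point_mass ` carrier G) = alg_space KG"
  proof (rule span_subspace)
    show "point_mass ` carrier G \<subseteq> alg_space KG"
      by (auto simp: group_algebra_space point_mass_def)
    show "alg_space KG \<subseteq> span (point_mass ` carrier G)"
    proof
      fix x assume "x \<in> alg_space KG"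
      then have "x = (\<Sum>h\<in>carrier G. alg_scale KG (x h) (point_mass h))"
        by (rule point_mass_expansion)
      also have "\<dots> \<in> span (point_mass ` carrier G)"
        by (rule span_sum, rule span_scale, rule span_base, rule imageI)
      finally show "x \<in> span (point_mass ` carrier G)" .
    qed
  qed (rule sub)
  moreover have "finite (point_mass ` carrier G)" using finite_group by simp
  ultimately have fin: "\<exists>F. finite F \<and> span F = alg_space KG" by blast
  have unit: "point_mass \<one> \<star> x = x \<and> x \<star> point_mass \<one> = x" if "x \<in> alg_space KG" for x
  proof -
    have "(point_mass \<one> \<star> x) g = x g \<and> (x \<star> point_mass \<one>) g = x g" for g
      using that by (cases "g \<in> carrier G")
        (auto simp: conv_point_mass_left conv_point_mass_right conv_outside group_algebra_space)
    then show ?thesis by blast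
  qed
  have conv_outside': "(x \<star> y) g = (if g \<in> carrier G then \<Sum>h\<in>carrier G. x h * y (inv h \<otimes> g) else 0)"
    for x y g by (simp add: conv_apply conv_outside)
  show "fd_algebra KG"
  proof
    show "alg_mult KG (x + y) z = alg_mult KG x z + alg_mult KG y z" for x y z
      by (rule ext) (simp add: conv_outside' algebra_simps sum.distrib)
    show "alg_mult KG x (y + z) = alg_mult KG x y + alg_mult KG x z" for x y z
      by (rule ext) (simp add: conv_outside' algebra_simps sum.distrib)
    show "alg_mult KG (alg_scale KG c x) y = alg_scale KG c (alg_mult KG x y)" for c x y
      by (rule ext) (simp add: conv_outside' group_algebra_scale sum_distrib_left mult_ac)
    show "alg_mult KG x (alg_scale KG c y) = alg_scale KG c (alg_mult KG x y)" for c x y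
      by (rule ext) (simp add: conv_outside' group_algebra_scale sum_distrib_left mult_ac)
    show "alg_one KG \<in> alg_space KG"
      by (simp add: group_algebra_one group_algebra_space point_mass_def)
    show "subspace (alg_space KG)" by (rule sub)
    show "\<exists>F. finite F \<and> span F = alg_space KG" by (rule fin)
  qed (simp_all add: unit conv_closed conv_assoc group_algebra_one)
qed

abbreviation ZKG :: "('k, 'g \<Rightarrow> 'k) alg" where "ZKG \<equiv> center_algebra KG"

sublocale ZKG: fd_algebra "center_algebra (group_algebra G :: ('k, 'g \<Rightarrow> 'k) alg)"
  by (rule KG.fd_algebra_center)

lemma center_algebra_simps:
  "alg_mult ZKG = alg_mult KG" "alg_one ZKG = alg_one KG" "alg_scale ZKG = alg_scale KG"
  "alg_space ZKG = alg_center KG"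
  by (simp_all add: center_algebra_def)

lemma center_space: "x \<in> alg_center KG \<Longrightarrow> x \<in> alg_space KG"
  by (simp add: alg_center_def)

lemma center_commute: "x \<in> alg_center KG \<Longrightarrow> y \<in> alg_space KG \<Longrightarrow> x \<star> y = y \<star> x"
  by (simp add: alg_center_def)

lemma center_iff_class_function:
  "x \<in> alg_center KG \<longleftrightarrow>
     x \<in> alg_space KG \<and> (\<forall>g\<in>carrier G. \<forall>h\<in>carrier G. x (g \<otimes> h) = x (h \<otimes> g))"
    (is "_ \<longleftrightarrow> _ \<and> ?class")
proof (intro iffI conjI)
  assume x: "x \<in> alg_center KG"
  then show "x \<in> alg_space KG" by (rule center_space)
  show ?class
  proof (intro ballI)
    fix g h assume g: "g \<in> carrier G" and h: "h \<in> carrier G"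
    have "point_mass (inv h) \<in> alg_space KG"
      using h by (auto simp: group_algebra_space point_mass_def)
    with x have "x \<star> point_mass (inv h) = point_mass (inv h) \<star> x"
      by (rule center_commute)
    from fun_cong[OF this, of g] show "x (g \<otimes> h) = x (h \<otimes> g)"
      using g h by (simp add: conv_point_mass_left conv_point_mass_right)
  qed
next
  assume x: "x \<in> alg_space KG \<and> ?class"
  have "(x \<star> y) g = (y \<star> x) g" for y g
  proof (cases "g \<in> carrier G")
    case True
    have "x (g \<otimes> inv h) * y h = y h * x (inv h \<otimes> g)" if "h \<in> carrier G" for h
      using x True that by simp
    then show ?thesis
      unfolding conv_apply'[OF True, of x y] conv_apply[OF True, of y x] by (rule sum.cong[OF refl])
  qed (simp add: conv_outside)
  then show "x \<in> alg_center KG" using x by (simp add: alg_center_def fun_eq_iff)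
qed

text \<open>
  This is \<open>\<Sum>\<^sub>h inv h \<otimes> g \<otimes> h\<close>, the class sum of \<open>g\<close> times the order of its centralizer. It pairs with a
  central element to \<open>|G|\<close> times a coefficient, where the class sum would give the size of the
  class as the factor.
\<close>

definition conjugate_sum :: "'g \<Rightarrow> 'g \<Rightarrow> 'k" where
  "conjugate_sum g = (\<lambda>k. if k \<in> carrier G
     then \<Sum>h\<in>carrier G. if h \<otimes> k \<otimes> inv h = g then 1 else 0 else 0)"

text \<open>
  Replacing \<open>h\<close> by \<open>h \<otimes> inv l\<close> in the sum moves \<open>l\<close> from one side of \<open>k\<close> to the other.
\<close>

lemma conjugate_sum_central: "conjugate_sum g \<in> alg_center KG"
  unfolding center_iff_class_function
proof (intro conjI ballI)
  show "conjugate_sum g \<in> alg_space KG" by (simp add: group_algebra_space conjugate_sum_def)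
  fix k l assume k: "k \<in> carrier G" and l: "l \<in> carrier G"
  have "(\<Sum>h\<in>carrier G. if h \<otimes> (l \<otimes> k) \<otimes> inv h = g then 1 else 0 :: 'k) =
      (\<Sum>h\<in>carrier G. if h \<otimes> inv l \<otimes> (l \<otimes> k) \<otimes> inv (h \<otimes> inv l) = g then 1 else 0)"
    using l sum_translate_right[of "inv l" "\<lambda>h. if h \<otimes> (l \<otimes> k) \<otimes> inv h = g then 1 else 0 :: 'k"]
    by simp
  also have "\<dots> = (\<Sum>h\<in>carrier G. if h \<otimes> (k \<otimes> l) \<otimes> inv h = g then 1 else 0)"
  proof (rule sum.cong[OF refl])
    fix h assume h: "h \<in> carrier G"
    have "h \<otimes> inv l \<otimes> (l \<otimes> k) \<otimes> inv (h \<otimes> inv l) = h \<otimes> (inv l \<otimes> l) \<otimes> k \<otimes> (l \<otimes> inv h)"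
      using h k l by (simp only: inv_mult_group inv_inv inv_closed m_closed m_assoc)
    also have "\<dots> = h \<otimes> (k \<otimes> l) \<otimes> inv h"
      using h k l by (simp add: m_assoc)
    finally show "(if h \<otimes> inv l \<otimes> (l \<otimes> k) \<otimes> inv (h \<otimes> inv l) = g then 1 else 0 :: 'k) =
        (if h \<otimes> (k \<otimes> l) \<otimes> inv h = g then 1 else 0)" by simp
  qed
  finally show "conjugate_sum g (k \<otimes> l) = conjugate_sum g (l \<otimes> k)"
    using k l by (simp add: conjugate_sum_def)
qed

text \<open>
  For each \<open>h\<close> exactly one \<open>k\<close> contributes, and its inverse is a conjugate of \<open>g\<close>, where the class
  function \<open>z\<close> takes the value \<open>z g\<close>.
\<close>

lemma conv_conjugate_sum:
  assumes z: "z \<in> alg_center KG" and g: "g \<in> carrier G"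
  shows "(z \<star> conjugate_sum (inv g)) \<one> = order_K * z g"
proof -
  have "(z \<star> conjugate_sum (inv g)) \<one> =
      (\<Sum>k\<in>carrier G. \<Sum>h\<in>carrier G. if h \<otimes> k \<otimes> inv h = inv g then z (inv k) else 0)"
    by (auto simp: conv_apply' conjugate_sum_def sum_distrib_left intro!: sum.cong)
  also have "\<dots> = (\<Sum>h\<in>carrier G. \<Sum>k\<in>carrier G. if h \<otimes> k \<otimes> inv h = inv g then z (inv k) else 0)"
    by (rule sum.swap)
  also have "\<dots> = (\<Sum>h\<in>carrier G. z g)"
  proof (rule sum.cong[OF refl])
    fix h assume h: "h \<in> carrier G"
    have eq: "h \<otimes> k \<otimes> inv h = inv g \<longleftrightarrow> k = inv h \<otimes> (inv g \<otimes> h)" if k: "k \<in> carrier G" for k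
    proof
      assume "h \<otimes> k \<otimes> inv h = inv g"
      then have "inv h \<otimes> (inv g \<otimes> h) = inv h \<otimes> ((h \<otimes> k \<otimes> inv h) \<otimes> h)" by simp
      also have "\<dots> = (inv h \<otimes> h) \<otimes> k \<otimes> (inv h \<otimes> h)"
        using h k by (simp only: m_assoc inv_closed m_closed)
      finally show "k = inv h \<otimes> (inv g \<otimes> h)" using h k by simp
    next
      assume "k = inv h \<otimes> (inv g \<otimes> h)"
      then have "h \<otimes> k \<otimes> inv h = (h \<otimes> inv h) \<otimes> inv g \<otimes> (h \<otimes> inv h)"
        using h g by (simp only: m_assoc inv_closed m_closed)
      then show "h \<otimes> k \<otimes> inv h = inv g" using h g by simp
    qed
    have "(\<Sum>k\<in>carrier G. if h \<otimes> k \<otimes> inv h = inv g then z (inv k) else 0) =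
        (\<Sum>k\<in>carrier G. if k = inv h \<otimes> (inv g \<otimes> h) then z (inv k) else 0)"
      using eq by (intro sum.cong) auto
    also have "\<dots> = z (inv h \<otimes> g \<otimes> h)"
      using g h finite_group by (simp add: inv_mult_group)
    also have "\<dots> = z (h \<otimes> (inv h \<otimes> g))"
      using z g h by (simp add: center_iff_class_function)
    also have "\<dots> = z g" using g h by (simp flip: m_assoc)
    finally show "(\<Sum>k\<in>carrier G. if h \<otimes> k \<otimes> inv h = inv g then z (inv k) else 0) = z g" .
  qed
  finally show ?thesis by simp
qed

text \<open>
  Testing against the conjugate sum of \<open>inv g\<close> gives \<open>|G|\<close> times the coefficient of \<open>z\<close> at
  \<open>g\<close>.
\<close>

lemma center_form_nondegenerate:
  assumes z: "z \<in> alg_center KG" and "\<And>y. y \<in> alg_center KG \<Longrightarrow> (z \<star> y) \<one> = 0"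
  shows "z = 0"
proof
  fix g
  show "z g = 0 g"
  proof (cases "g \<in> carrier G")
    case True
    then have "order_K * z g = 0"
      using conv_conjugate_sum[OF z] assms(2)[OF conjugate_sum_central] by metis
    then show ?thesis using order_nonzero by simp
  next
    case False
    then show ?thesis using center_space[OF z] by (simp add: group_algebra_space)
  qed
qed

text \<open>
  The character of the regular representation is concentrated at the unit. It turns the
  coefficient at \<open>\<one>\<close> into a trace, which is why \<open>l\<^sub>A\<close> vanishes on square-zero elements.
\<close>

lemma trace_left_multiplication:
  "KG.trace_on (alg_space KG) (\<lambda>y. x \<star> y) = order_K * x \<one>"
proof -
  obtain F where F: "finite F" "KG.span F = alg_space KG" using KG.finite_dim by blast
  have "KG.trace_on (alg_space KG) (\<lambda>y. x \<star> y) = (\<Sum>h\<in>carrier G. (x \<star> point_mass h) h)"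
  proof (rule KG.trace_on_eq_sum[OF KG.subspace_space F(1) _ finite_group,
        where c = "\<lambda>h y. y h" and u = "\<lambda>h. x \<star> point_mass h"])
    show "x \<star> y = (\<Sum>h\<in>carrier G. alg_scale KG (y h) (x \<star> point_mass h))" for y
    proof
      fix g
      show "(x \<star> y) g = (\<Sum>h\<in>carrier G. alg_scale KG (y h) (x \<star> point_mass h)) g"
        by (cases "g \<in> carrier G") (simp_all add: sum_fun_apply group_algebra_scale conv_outside
            conv_apply'[of g x y] conv_point_mass_right mult.commute)
    qed
  qed (simp_all add: F conv_closed group_algebra_scale)
  also have "\<dots> = order_K * x \<one>" by (simp add: conv_point_mass_right)
  finally show ?thesis .
qed

lemma unit_coefficient_square_zero:
  assumes x: "x \<in> alg_space KG" and "x \<star> x = 0"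
  shows "x \<one> = 0"
proof -
  obtain F where F: "finite F" "KG.span F = alg_space KG" using KG.finite_dim by blast
  have "KG.trace_on (alg_space KG) (\<lambda>y. x \<star> y) = 0"
    using F assms by (intro KG.trace_on_square_zero[OF KG.subspace_space F(1)])
      (simp_all add: KG.distrib_left KG.scale_mult_right conv_closed flip: conv_assoc)
  then show ?thesis using order_nonzero by (simp add: trace_left_multiplication)
qed

lemma center_functional_eq:
  fixes \<mu> :: "'g \<Rightarrow> 'k"
  shows "center_functional G \<mu> x = (\<mu> \<star> \<mu> \<star> x) \<one> / order_K"
  by (simp add: center_functional_def Let_def group_algebra_scale)

end

text \<open>
  The inverse \<open>\<nu>\<close> of \<open>\<mu>\<close> is carried along because the dual map is expressed through it.
\<close>

locale central_unit = nonmodular_group G "field_type :: 'k itself"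
  for G :: "('g, 'm) monoid_scheme" (structure) and field_type :: "'k::field itself" +
  fixes \<mu> \<nu> :: "'g \<Rightarrow> 'k"
  assumes unit_central: "\<mu> \<in> alg_center KG" and inverse_central: "\<nu> \<in> alg_center KG"
    and inverse_unit: "\<nu> \<star> \<mu> = alg_one KG"
begin

lemma inverse_unit_cancel: "x \<in> alg_space KG \<Longrightarrow> \<nu> \<star> (\<mu> \<star> x) = x"
  by (simp add: inverse_unit KG.one_left flip: conv_assoc)

lemma unit_inverse_cancel: "x \<in> alg_space KG \<Longrightarrow> \<mu> \<star> (\<nu> \<star> x) = x"
  using center_commute[OF unit_central center_space[OF inverse_central]]
  by (simp add: inverse_unit KG.one_left flip: conv_assoc)

lemma center_frobenius_pair: "frobenius_pair ZKG (center_functional G \<mu>)"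
proof
  have sq: "\<mu> \<star> \<mu> \<in> alg_center KG" using unit_central KG.center_mult_closed by blast
  show "center_functional G \<mu> (x + y) = center_functional G \<mu> x + center_functional G \<mu> y"
    if "x \<in> alg_space ZKG" "y \<in> alg_space ZKG" for x y
    using that by (simp add: center_functional_eq center_algebra_simps center_space KG.distrib_left
        conv_closed add_divide_distrib)
  show "center_functional G \<mu> (alg_scale ZKG c x) = c * center_functional G \<mu> x"
    if "x \<in> alg_space ZKG" for c x
    using that by (simp add: center_functional_eq center_algebra_simps center_space
        KG.scale_mult_right conv_closed group_algebra_scale)
  show "frob_form ZKG (center_functional G \<mu>) x y = frob_form ZKG (center_functional G \<mu>) y x"
    if "x \<in> alg_space ZKG" "y \<in> alg_space ZKG" for x y
    using that center_commute by (simp add: frob_form_def center_algebra_simps center_space)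
  show "x = 0"
    if x: "x \<in> alg_space ZKG" and
      zero: "\<forall>y\<in>alg_space ZKG. frob_form ZKG (center_functional G \<mu>) x y = 0" for x
  proof -
    have xZ: "x \<in> alg_center KG" using x by (simp add: center_algebra_simps)
    have "\<mu> \<star> \<mu> \<star> x = 0"
    proof (rule center_form_nondegenerate)
      show "\<mu> \<star> \<mu> \<star> x \<in> alg_center KG" using sq xZ KG.center_mult_closed by blast
      show "(\<mu> \<star> \<mu> \<star> x \<star> y) \<one> = 0" if "y \<in> alg_center KG" for y
        using zero that order_nonzero
        by (simp add: frob_form_def center_functional_eq center_algebra_simps conv_assoc)
    qed
    moreover have "x = \<nu> \<star> (\<nu> \<star> (\<mu> \<star> \<mu> \<star> x))"
      using xZ by (simp add: conv_assoc inverse_unit_cancel conv_closed center_space)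
    ultimately show "x = 0" using inverse_central center_space by simp
  qed
qed

sublocale A: frobenius_pair "center_algebra (group_algebra G :: ('k, 'g \<Rightarrow> 'k) alg)"
  "center_functional G \<mu>"
  by (rule center_frobenius_pair)

text \<open>
  The element \<open>\<mu> \<star> \<mu> \<star> x\<close> has square zero whenever \<open>x\<close> has.
\<close>

lemma semisimple_center: "semisimple_alg ZKG"
proof (rule A.semisimple_if_kills_square_zero)
  fix x assume x: "x \<in> alg_space ZKG" and "alg_mult ZKG x x = 0"
  then have xZ: "x \<in> alg_center KG" and xx: "x \<star> x = 0" by (simp_all add: center_algebra_simps)
  have "(\<mu> \<star> \<mu> \<star> x) \<star> (\<mu> \<star> \<mu> \<star> x) = (\<mu> \<star> \<mu>) \<star> ((\<mu> \<star> \<mu>) \<star> (x \<star> x))"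
    using center_commute[OF xZ conv_closed, of "\<mu> \<star> \<mu>" x] by (simp add: conv_assoc)
  then have "(\<mu> \<star> \<mu> \<star> x) \<one> = 0"
    by (intro unit_coefficient_square_zero) (simp_all add: conv_closed xx)
  then show "center_functional G \<mu> x = 0" by (simp add: center_functional_eq)
qed

end


section \<open>Intertwining operators\<close>

locale nonmodular_representation = fd_representation G scale \<rho> +
    nonmodular_group G "field_type :: 'k itself"
  for G :: "('g, 'm) monoid_scheme" (structure)
    and scale :: "'k::field \<Rightarrow> 'v::ab_group_add \<Rightarrow> 'v" (infixr "*s" 75) and \<rho> and field_type
begin

abbreviation linear_op :: "('v \<Rightarrow> 'v) \<Rightarrow> bool" where
  "linear_op \<equiv> Vector_Spaces.linear scale scale"

abbreviation Tr :: "('v \<Rightarrow> 'v) \<Rightarrow> 'k" where "Tr \<equiv> trace_on UNIV"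

definition V_basis :: "'v set" where
  "V_basis = (SOME V_basis. finite V_basis \<and> independent V_basis \<and> span V_basis = UNIV)"

lemma V_basis: "finite V_basis" "independent V_basis" "span V_basis = UNIV"
proof -
  obtain F where "finite F" "span F = UNIV" using finite_dim by blast
  then have "\<exists>V_basis. finite V_basis \<and> independent V_basis \<and> span V_basis = UNIV"
    using subspace_basis[OF subspace_UNIV, of F] by (metis subset_UNIV)
  then have "finite V_basis \<and> independent V_basis \<and> span V_basis = UNIV"
    unfolding V_basis_def by (rule someI_ex)
  then show "finite V_basis" "independent V_basis" "span V_basis = UNIV" by blast+
qed

abbreviation coord :: "'v \<Rightarrow> 'v \<Rightarrow> 'k" where "coord i v \<equiv> representation V_basis v i"

lemma coord_add: "coord i (v + w) = coord i v + coord i w"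
  using V_basis by (simp add: representation_add)

lemma coord_scale: "coord i (c *s v) = c * coord i v"
  using V_basis by (simp add: representation_scale)

lemma coord_sum: "coord i (\<Sum>a\<in>I. f a) = (\<Sum>a\<in>I. coord i (f a))"
  using V_basis by (simp add: representation_sum)

lemma coord_expansion: "(\<Sum>i\<in>V_basis. coord i v *s i) = v"
  using V_basis by (simp add: sum_representation_eq)

lemma linear_opI:
  assumes "\<And>v w. f (v + w) = f v + f w" "\<And>c v. f (c *s v) = c *s f v"
  shows "linear_op f"
  using assms vector_space_axioms by (simp add: Vector_Spaces.linear_iff)

lemma linear_opD:
  assumes "linear_op f"
  shows "f (v + w) = f v + f w" "f (c *s v) = c *s f v" "f (sum h I) = (\<Sum>i\<in>I. f (h i))"
proof -
  interpret f: Vector_Spaces.linear scale scale f by fact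
  show "f (v + w) = f v + f w" "f (c *s v) = c *s f v" "f (sum h I) = (\<Sum>i\<in>I. f (h i))"
    by (rule f.add, rule f.scale, rule f.sum)
qed

lemma linear_op_zero: "linear_op f \<Longrightarrow> f 0 = 0"
  using linear_opD(2)[of f 0 0] by simp

lemma linear_op_comp: "linear_op f \<Longrightarrow> linear_op g \<Longrightarrow> linear_op (f \<circ> g)"
  by (rule linear_opI) (simp_all add: linear_opD)

lemma linear_op_combination:
  "(\<And>i. i \<in> I \<Longrightarrow> linear_op (f i)) \<Longrightarrow> linear_op (\<lambda>v. \<Sum>i\<in>I. c i *s f i v)"
  by (rule linear_opI)
    (simp_all add: linear_opD scale_right_distrib sum.distrib scale_sum_right mult.commute)

lemmas Tr_basis = trace_basis[OF V_basis]
lemmas Tr_commute = trace_comp_commute[OF V_basis]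

lemma Tr_combination:
  assumes "\<And>i. i \<in> I \<Longrightarrow> linear_op (f i)"
  shows "Tr (\<lambda>v. \<Sum>i\<in>I. c i *s f i v) = (\<Sum>i\<in>I. c i * Tr (f i))"
proof -
  have "Tr (\<lambda>v. \<Sum>i\<in>I. c i *s f i v) = (\<Sum>e\<in>V_basis. \<Sum>i\<in>I. c i * coord e (f i e))"
    using assms by (simp add: Tr_basis linear_op_combination coord_sum coord_scale)
  also have "\<dots> = (\<Sum>i\<in>I. \<Sum>e\<in>V_basis. c i * coord e (f i e))" by (rule sum.swap)
  also have "\<dots> = (\<Sum>i\<in>I. c i * Tr (f i))"
    using assms by (simp add: Tr_basis sum_distrib_left)
  finally show ?thesis .
qed

lemma Tr_scaled: "linear_op f \<Longrightarrow> Tr (\<lambda>v. c *s f v) = c * Tr f"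
  using Tr_combination[of "{()}" "\<lambda>_. f" "\<lambda>_. c"] by simp

text \<open>
  The operators \<open>v \<mapsto> coord e v *s w\<close> of rank at most one give \<open>Tr (z \<circ> y) = coord e (z w)\<close>, so
  all coordinates of \<open>z w\<close> vanish.
\<close>

lemma trace_form_nondegenerate:
  assumes z: "linear_op z" and zero: "\<And>y. linear_op y \<Longrightarrow> Tr (z \<circ> y) = 0"
  shows "z = 0"
proof
  fix w
  have "coord e (z w) = 0" if e: "e \<in> V_basis" for e
  proof -
    let ?y = "\<lambda>v. coord e v *s w"
    have y: "linear_op ?y"
      by (rule linear_opI) (simp_all add: coord_add coord_scale scale_left_distrib)
    have "Tr (z \<circ> ?y) = (\<Sum>i\<in>V_basis. coord e i * coord i (z w))"
      by (simp add: Tr_basis linear_op_comp z y linear_opD[OF z] coord_scale)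
    also have "\<dots> = (\<Sum>i\<in>V_basis. if i = e then coord e (z w) else 0)"
      by (intro sum.cong refl) (use V_basis in \<open>auto simp: representation_basis\<close>)
    also have "\<dots> = coord e (z w)" using V_basis e by simp
    finally show ?thesis using zero[OF y] by simp
  qed
  then have "(\<Sum>e\<in>V_basis. coord e (z w) *s e) = 0" by simp
  then show "z w = 0 w" by (simp add: coord_expansion)
qed

definition matrix_unit :: "'v \<times> 'v \<Rightarrow> 'v \<Rightarrow> 'v" where
  "matrix_unit p v = coord (snd p) v *s fst p"

lemma linear_matrix_unit: "linear_op (matrix_unit p)"
  by (rule linear_opI) (simp_all add: matrix_unit_def coord_add coord_scale scale_left_distrib)

text \<open>
  The matrix entries of an operator are the functionals to which \<open>trace_on_eq_sum\<close> is applied on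
  the space of intertwining operators.
\<close>

lemma matrix_unit_expansion:
  assumes x: "linear_op x"
  shows "x v = (\<Sum>p\<in>V_basis \<times> V_basis. coord (fst p) (x (snd p)) *s matrix_unit p v)"
proof -
  have "x v = (\<Sum>j\<in>V_basis. coord j v *s x j)"
    by (rule linear_basis_expansion[OF V_basis x])
  also have "\<dots> = (\<Sum>j\<in>V_basis. coord j v *s (\<Sum>i\<in>V_basis. coord i (x j) *s i))"
    by (simp add: coord_expansion)
  also have "\<dots> = (\<Sum>j\<in>V_basis. \<Sum>i\<in>V_basis. coord i (x j) *s coord j v *s i)"
    by (simp add: scale_sum_right mult.commute)
  also have "\<dots> = (\<Sum>i\<in>V_basis. \<Sum>j\<in>V_basis. coord i (x j) *s coord j v *s i)"
    by (rule sum.swap)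
  also have "\<dots> = (\<Sum>p\<in>V_basis \<times> V_basis. coord (fst p) (x (snd p)) *s matrix_unit p v)"
    by (simp add: sum.cartesian_product matrix_unit_def case_prod_beta)
  finally show ?thesis .
qed

abbreviation BG :: "('k, 'v \<Rightarrow> 'v) alg" where "BG \<equiv> intertwiner_algebra G scale \<rho>"

lemma intertwiner_simps:
  "alg_mult BG = (\<circ>)" "alg_one BG = id" "alg_scale BG c f = (\<lambda>v. c *s f v)"
  by (simp_all add: intertwiner_algebra_def)

lemma intertwiner_space:
  "f \<in> alg_space BG \<longleftrightarrow> linear_op f \<and> (\<forall>g\<in>carrier G. \<forall>v. f (\<rho> g v) = \<rho> g (f v))"
  by (auto simp: intertwiner_algebra_def fun_eq_iff)

lemma intertwiner_linear: "f \<in> alg_space BG \<Longrightarrow> linear_op f"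
  by (simp add: intertwiner_space)

lemma rep_inverse:
  assumes "g \<in> carrier G"
  shows "\<rho> g (\<rho> (inv g) v) = v" "\<rho> (inv g) (\<rho> g v) = v"
  using rep_mult[of g "inv g"] rep_mult[of "inv g" g] rep_one assms
  by (simp_all add: fun_eq_iff)

lemma rep_mult': "g \<in> carrier G \<Longrightarrow> h \<in> carrier G \<Longrightarrow> \<rho> g (\<rho> h v) = \<rho> (g \<otimes> h) v"
  by (simp add: rep_mult)

lemma intertwiner_closed: "f \<in> alg_space BG \<Longrightarrow> h \<in> alg_space BG \<Longrightarrow> f \<circ> h \<in> alg_space BG"
  by (simp add: intertwiner_space linear_op_comp)

sublocale B: fd_algebra "intertwiner_algebra G scale \<rho>"
proof -
  interpret ops: vector_space "alg_scale BG"
    by unfold_locales (auto simp: intertwiner_simps algebra_simps fun_eq_iff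
        scale_right_distrib scale_left_distrib)
  have sub: "ops.subspace (alg_space BG)"
  proof (rule ops.subspaceI)
    show "0 \<in> alg_space BG"
      by (auto simp: intertwiner_space linear_op_zero linear_rep intro!: linear_opI)
    show "x + y \<in> alg_space BG" if "x \<in> alg_space BG" "y \<in> alg_space BG" for x y
      using that linear_opD(1)[OF linear_rep]
      by (auto simp: intertwiner_space linear_opD(1,2) scale_right_distrib intro!: linear_opI)
    show "alg_scale BG c x \<in> alg_space BG" if "x \<in> alg_space BG" for c x
      using that linear_opD(2)[OF linear_rep]
      by (auto simp: intertwiner_space intertwiner_simps linear_opD(1,2) scale_right_distrib
          mult.commute intro!: linear_opI)
  qed
  have fin: "finite (matrix_unit ` (V_basis \<times> V_basis))" using V_basis by simp
  have "alg_space BG \<subseteq> ops.span (matrix_unit ` (V_basis \<times> V_basis))"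
  proof
    fix x assume "x \<in> alg_space BG"
    then have x: "linear_op x" by (rule intertwiner_linear)
    have "x = (\<Sum>p\<in>V_basis \<times> V_basis. alg_scale BG (coord (fst p) (x (snd p))) (matrix_unit p))"
      by (rule ext, subst matrix_unit_expansion[OF x]) (simp add: sum_fun_apply intertwiner_simps)
    also have "\<dots> \<in> ops.span (matrix_unit ` (V_basis \<times> V_basis))"
      by (rule ops.span_sum, rule ops.span_scale, rule ops.span_base, rule imageI)
    finally show "x \<in> ops.span (matrix_unit ` (V_basis \<times> V_basis))" .
  qed
  then obtain D where D: "finite D" "ops.span D = alg_space BG"
    by (rule ops.subspace_basis[OF sub fin])
  show "fd_algebra BG"
  proof
    show "ops.subspace (alg_space BG)" by (rule sub)
    show "\<exists>F. finite F \<and> ops.span F = alg_space BG" using D by blast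
    show "alg_one BG \<in> alg_space BG"
      by (auto simp: intertwiner_simps intertwiner_space intro!: linear_opI)
    show "alg_mult BG x (y + z) = alg_mult BG x y + alg_mult BG x z"
      if "x \<in> alg_space BG" for x y z
      using linear_opD(1)[OF intertwiner_linear[OF that]] by (simp add: intertwiner_simps fun_eq_iff)
    show "alg_mult BG x (alg_scale BG c y) = alg_scale BG c (alg_mult BG x y)"
      if "x \<in> alg_space BG" for c x y
      using linear_opD(2)[OF intertwiner_linear[OF that]] by (simp add: intertwiner_simps fun_eq_iff)
  qed (simp_all add: intertwiner_simps intertwiner_closed comp_assoc fun_eq_iff)
qed

text \<open>
  The averaging projection of all linear operators onto the intertwining ones; the factor
  \<open>1 / order_K\<close> makes it the identity on the latter.
\<close>

definition conjugation_average :: "('v \<Rightarrow> 'v) \<Rightarrow> 'v \<Rightarrow> 'v" where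
  "conjugation_average x v = (\<Sum>g\<in>carrier G. (1 / order_K) *s (\<rho> g \<circ> x \<circ> \<rho> (inv g)) v)"

lemma linear_conjugate:
  "linear_op x \<Longrightarrow> g \<in> carrier G \<Longrightarrow> linear_op (\<rho> g \<circ> x \<circ> \<rho> (inv g))"
  by (simp add: linear_op_comp linear_rep)

lemma conjugation_average_intertwines:
  assumes x: "linear_op x"
  shows "conjugation_average x \<in> alg_space BG"
  unfolding intertwiner_space
proof (intro conjI ballI allI)
  show "linear_op (conjugation_average x)"
    unfolding conjugation_average_def [abs_def]
    by (rule linear_op_combination) (rule linear_conjugate[OF x])
  fix h v assume h: "h \<in> carrier G"
  have "\<rho> h (conjugation_average x v) =
      (\<Sum>g\<in>carrier G. (1 / order_K) *s \<rho> (h \<otimes> g) (x (\<rho> (inv (h \<otimes> g)) (\<rho> h v))))"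
  proof -
    \<comment> \<open>With index \<open>h \<otimes> g\<close> the argument \<open>v\<close> turns into \<open>\<rho> h v\<close>, so the sum is a translate of the
      average at \<open>\<rho> h v\<close>.\<close>
    have "\<rho> (inv (h \<otimes> g)) (\<rho> h v) = \<rho> (inv g) v" if "g \<in> carrier G" for g
      using h that by (simp add: rep_mult' inv_mult_group m_assoc)
    then show ?thesis
      using h by (simp add: conjugation_average_def linear_opD[OF linear_rep[OF h]] rep_mult')
  qed
  also have "\<dots> = conjugation_average x (\<rho> h v)"
    unfolding conjugation_average_def comp_apply
    by (rule sum_translate_left[OF h, where f = "\<lambda>g. (1 / order_K) *s \<rho> g (x (\<rho> (inv g) (\<rho> h v)))"])
  finally show "conjugation_average x (\<rho> h v) = \<rho> h (conjugation_average x v)" by simp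
qed

lemma conjugation_average_id:
  assumes "x \<in> alg_space BG"
  shows "conjugation_average x v = x v"
proof -
  have "conjugation_average x v = (\<Sum>g\<in>carrier G. (1 / order_K) *s x v)"
    using assms by (simp add: conjugation_average_def intertwiner_space rep_inverse)
  also have "\<dots> = x v"
    using order_nonzero by (simp flip: scale_sum_left)
  finally show ?thesis .
qed

text \<open>
  As \<open>z\<close> commutes with the group, \<open>Tr (z \<circ> y)\<close> does not change when \<open>y\<close> is averaged over
  conjugation. Hence vanishing on intertwining operators implies vanishing on all operators.
\<close>

lemma intertwiner_form_nondegenerate:
  assumes z: "z \<in> alg_space BG" and zero: "\<And>y. y \<in> alg_space BG \<Longrightarrow> Tr (z \<circ> y) = 0"
  shows "z = 0"
proof (rule trace_form_nondegenerate)
  show zl: "linear_op z" using z by (rule intertwiner_linear)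
  fix y assume y: "linear_op y"
  have conj: "Tr (z \<circ> (\<rho> g \<circ> y \<circ> \<rho> (inv g))) = Tr (z \<circ> y)" if g: "g \<in> carrier G" for g
  proof -
    have "z \<circ> (\<rho> g \<circ> y \<circ> \<rho> (inv g)) = \<rho> g \<circ> (z \<circ> y \<circ> \<rho> (inv g))"
      using z g by (simp add: intertwiner_space fun_eq_iff)
    then have "Tr (z \<circ> (\<rho> g \<circ> y \<circ> \<rho> (inv g))) = Tr (\<rho> g \<circ> (z \<circ> y \<circ> \<rho> (inv g)))"
      by (rule arg_cong)
    also have "\<dots> = Tr ((z \<circ> y \<circ> \<rho> (inv g)) \<circ> \<rho> g)"
      using zl y g by (intro Tr_commute) (simp_all add: linear_op_comp linear_rep)
    also have "(z \<circ> y \<circ> \<rho> (inv g)) \<circ> \<rho> g = z \<circ> y"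
      using g by (simp add: rep_inverse fun_eq_iff)
    finally show ?thesis .
  qed
  have avg: "z \<circ> conjugation_average y =
      (\<lambda>v. \<Sum>g\<in>carrier G. (1 / order_K) *s (z \<circ> (\<rho> g \<circ> y \<circ> \<rho> (inv g))) v)"
    by (simp add: conjugation_average_def linear_opD[OF zl] fun_eq_iff)
  have "0 = Tr (z \<circ> conjugation_average y)"
    using zero[OF conjugation_average_intertwines[OF y]] by simp
  also have "\<dots> = (\<Sum>g\<in>carrier G. (1 / order_K) * Tr (z \<circ> (\<rho> g \<circ> y \<circ> \<rho> (inv g))))"
    unfolding avg
    by (rule Tr_combination[where f = "\<lambda>g. z \<circ> (\<rho> g \<circ> y \<circ> \<rho> (inv g))"])
      (simp add: zl y linear_op_comp linear_rep)
  also have "\<dots> = Tr (z \<circ> y)" using order_nonzero by (simp add: conj)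
  finally show "Tr (z \<circ> y) = 0" by simp
qed

lemma trace_square_zero:
  assumes "linear_op x" "x \<circ> x = 0"
  shows "Tr x = 0"
proof (rule trace_on_square_zero[OF subspace_UNIV V_basis(1)])
  show "x (x v) = 0" for v using fun_cong[OF assms(2), of v] by simp
qed (simp_all add: V_basis linear_opD[OF assms(1)])

abbreviation \<Phi> :: "('g \<Rightarrow> 'k) \<Rightarrow> 'v \<Rightarrow> 'v" where "\<Phi> \<equiv> group_algebra_action G scale \<rho>"

lemma action_apply: "\<Phi> x v = (\<Sum>g\<in>carrier G. x g *s \<rho> g v)"
  by (simp add: group_algebra_action_def)

lemma linear_action: "linear_op (\<Phi> x)"
  unfolding action_apply [abs_def] by (rule linear_op_combination) (rule linear_rep)

lemma action_mult: "\<Phi> (x \<star> y) = \<Phi> x \<circ> \<Phi> y"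
proof
  fix v
  have "\<Phi> (x \<star> y) v = (\<Sum>g\<in>carrier G. \<Sum>h\<in>carrier G. (x h * y (inv h \<otimes> g)) *s \<rho> g v)"
    by (simp add: action_apply conv_apply scale_sum_left)
  also have "\<dots> = (\<Sum>h\<in>carrier G. \<Sum>g\<in>carrier G. (x h * y (inv h \<otimes> g)) *s \<rho> g v)"
    by (rule sum.swap)
  also have "\<dots> = (\<Sum>h\<in>carrier G. \<Sum>k\<in>carrier G. (x h * y k) *s \<rho> (h \<otimes> k) v)"
  proof (rule sum.cong[OF refl])
    fix h assume h: "h \<in> carrier G"
    have "inv h \<otimes> (h \<otimes> k) = k" if "k \<in> carrier G" for k
      using h that by (simp flip: m_assoc)
    then show "(\<Sum>g\<in>carrier G. (x h * y (inv h \<otimes> g)) *s \<rho> g v) =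
        (\<Sum>k\<in>carrier G. (x h * y k) *s \<rho> (h \<otimes> k) v)"
      using sum_translate_left[OF h, of "\<lambda>g. (x h * y (inv h \<otimes> g)) *s \<rho> g v"] by simp
  qed
  also have "\<dots> = (\<Phi> x \<circ> \<Phi> y) v"
    by (simp add: action_apply linear_opD[OF linear_rep] scale_sum_right rep_mult')
  finally show "\<Phi> (x \<star> y) v = (\<Phi> x \<circ> \<Phi> y) v" .
qed

lemma action_one: "\<Phi> (alg_one KG) = id"
proof
  fix v
  have "\<Phi> (alg_one KG) v = (\<Sum>g\<in>carrier G. if g = \<one> then \<rho> g v else 0)"
    by (auto simp: action_apply group_algebra_one point_mass_def intro!: sum.cong)
  then show "\<Phi> (alg_one KG) v = id v" using finite_group by (simp add: rep_one)
qed

lemma action_intertwiner_commute: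
  assumes "f \<in> alg_space BG"
  shows "\<Phi> x (f v) = f (\<Phi> x v)"
  using assms
  by (simp add: action_apply intertwiner_space linear_opD(2,3)[OF intertwiner_linear[OF assms]])

text \<open>
  In \<open>\<Sum> z h *s \<rho> (h \<otimes> g) v\<close> the summation index \<open>h\<close> is replaced by \<open>g \<otimes> h \<otimes> inv g\<close>, which leaves the
  class function \<open>z\<close> unchanged.
\<close>

lemma central_action_intertwines:
  assumes z: "z \<in> alg_center KG"
  shows "\<Phi> z \<in> alg_space BG"
  unfolding intertwiner_space
proof (intro conjI ballI allI)
  fix g v assume g: "g \<in> carrier G"
  have "\<Phi> z (\<rho> g v) = (\<Sum>h\<in>carrier G. z h *s \<rho> (h \<otimes> g) v)"
    using g by (simp add: action_apply rep_mult')
  also have "\<dots> = (\<Sum>h\<in>carrier G. z (g \<otimes> h \<otimes> inv g) *s \<rho> (g \<otimes> h \<otimes> inv g \<otimes> g) v)"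
    using g sum_translate_left[OF g, of "\<lambda>h. z (h \<otimes> inv g) *s \<rho> (h \<otimes> inv g \<otimes> g) v"]
      sum_translate_right[of "inv g" "\<lambda>h. z h *s \<rho> (h \<otimes> g) v"] by simp
  also have "\<dots> = (\<Sum>h\<in>carrier G. z h *s \<rho> (g \<otimes> h) v)"
  proof (rule sum.cong[OF refl])
    fix h assume h: "h \<in> carrier G"
    have "z (g \<otimes> h \<otimes> inv g) = z (inv g \<otimes> (g \<otimes> h))"
      using z g h by (simp add: center_iff_class_function)
    also have "\<dots> = z h" using g h by (simp flip: m_assoc)
    finally show "z (g \<otimes> h \<otimes> inv g) *s \<rho> (g \<otimes> h \<otimes> inv g \<otimes> g) v = z h *s \<rho> (g \<otimes> h) v"
      using g h by (simp add: m_assoc)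
  qed
  also have "\<dots> = \<rho> g (\<Phi> z v)"
    using g by (simp add: action_apply linear_opD[OF linear_rep[OF g]] rep_mult')
  finally show "\<Phi> z (\<rho> g v) = \<rho> g (\<Phi> z v)" .
qed (rule linear_action)

lemma central_action_hom: "alg_hom ZKG BG \<Phi>"
  by (auto simp: alg_hom_def center_algebra_simps central_action_intertwines action_mult action_one
      intertwiner_simps action_apply group_algebra_scale fun_eq_iff scale_left_distrib
      sum.distrib scale_sum_right)

lemma central_action_central: "\<Phi> ` alg_space ZKG \<subseteq> alg_center BG"
  by (auto simp: alg_center_def center_algebra_simps central_action_intertwines intertwiner_simps
      fun_eq_iff action_intertwiner_commute)

text \<open>
  The element \<open>\<Sum>\<^sub>g Tr (\<rho> (inv g) \<circ> b) g\<close> of the group algebra. It represents the functional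
  \<open>a \<mapsto> Tr (\<Phi> a \<circ> b)\<close> with respect to the form given by the coefficient at the unit, so that it is the
  dual map up to a power of \<open>\<mu>\<close>.
\<close>

definition character_sum :: "('v \<Rightarrow> 'v) \<Rightarrow> 'g \<Rightarrow> 'k" where
  "character_sum b g = (if g \<in> carrier G then Tr (\<rho> (inv g) \<circ> b) else 0)"

lemma character_sum_central:
  assumes b: "b \<in> alg_space BG"
  shows "character_sum b \<in> alg_center KG"
  unfolding center_iff_class_function
proof (intro conjI ballI)
  show "character_sum b \<in> alg_space KG" by (simp add: group_algebra_space character_sum_def)
  fix g h assume g: "g \<in> carrier G" and h: "h \<in> carrier G"
  note bl = intertwiner_linear[OF b]
  have "\<rho> (inv (g \<otimes> h)) \<circ> b = \<rho> (inv h) \<circ> (\<rho> (inv g) \<circ> b)"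
    using g h by (simp add: inv_mult_group rep_mult comp_assoc)
  then have "Tr (\<rho> (inv (g \<otimes> h)) \<circ> b) = Tr (\<rho> (inv h) \<circ> (\<rho> (inv g) \<circ> b))"
    by (rule arg_cong)
  also have "\<dots> = Tr ((\<rho> (inv g) \<circ> b) \<circ> \<rho> (inv h))"
    using g h bl by (intro Tr_commute) (simp_all add: linear_op_comp linear_rep)
  also have "(\<rho> (inv g) \<circ> b) \<circ> \<rho> (inv h) = \<rho> (inv (h \<otimes> g)) \<circ> b"
    using b g h by (simp add: inv_mult_group rep_mult intertwiner_space fun_eq_iff)
  finally show "character_sum b (g \<otimes> h) = character_sum b (h \<otimes> g)"
    using g h by (simp only: character_sum_def m_closed if_True)
qed

lemma character_sum_pairing:
  assumes b: "linear_op b"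
  shows "(character_sum b \<star> a) \<one> = Tr (\<Phi> a \<circ> b)"
proof -
  have "\<Phi> a \<circ> b = (\<lambda>v. \<Sum>g\<in>carrier G. a g *s (\<rho> g \<circ> b) v)"
    by (simp add: fun_eq_iff action_apply)
  then have "Tr (\<Phi> a \<circ> b) = (\<Sum>g\<in>carrier G. a g * Tr (\<rho> g \<circ> b))"
    using b by (simp only: Tr_combination linear_op_comp linear_rep)
  then show ?thesis
    by (simp add: conv_apply' character_sum_def mult.commute)
qed

text \<open>
  On the space of all operators, \<open>x \<mapsto> a \<circ> x \<circ> b\<close> has trace \<open>Tr a * Tr b\<close>. To descend to the
  intertwining operators, the value is averaged over conjugation, which changes nothing there but
  makes every matrix unit contribute an intertwining operator. The trace then is the mean over \<open>g\<close>
  of the traces of \<open>x \<mapsto> \<rho> g \<circ> b' \<circ> x \<circ> b'' \<circ> \<rho> (inv g)\<close> on all operators.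
\<close>

lemma trace_two_sided_multiplication:
  assumes b': "b' \<in> alg_space BG" and b'': "b'' \<in> alg_space BG"
  shows "B.trace_on (alg_space BG) (\<lambda>b. b' \<circ> b \<circ> b'') =
    (\<Sum>g\<in>carrier G. Tr (\<rho> g \<circ> b') * Tr (\<rho> (inv g) \<circ> b'')) / order_K"
proof -
  note l' = intertwiner_linear[OF b'] and l'' = intertwiner_linear[OF b'']
  have lin: "linear_op (b' \<circ> matrix_unit p \<circ> b'')" for p
    by (simp add: linear_op_comp l' l'' linear_matrix_unit)
  obtain F where F: "finite F" "B.span F = alg_space BG" using B.finite_dim by blast
  have "B.trace_on (alg_space BG) (\<lambda>b. b' \<circ> b \<circ> b'') =
      (\<Sum>p\<in>V_basis \<times> V_basis. coord (fst p) (conjugation_average (b' \<circ> matrix_unit p \<circ> b'') (snd p)))"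
  proof (rule B.trace_on_eq_sum[OF B.subspace_space F(1),
        where c = "\<lambda>p x. coord (fst p) (x (snd p))"
          and u = "\<lambda>p. conjugation_average (b' \<circ> matrix_unit p \<circ> b'')"])
    fix x assume x: "x \<in> alg_space BG"
    note lx = intertwiner_linear[OF x]
    show "b' \<circ> x \<circ> b'' = (\<Sum>p\<in>V_basis \<times> V_basis. alg_scale BG (coord (fst p) (x (snd p)))
        (conjugation_average (b' \<circ> matrix_unit p \<circ> b'')))"
    proof
      fix v
      have "b' \<circ> x \<circ> b'' \<in> alg_space BG" using b' x b'' by (simp add: intertwiner_closed)
      then have "(b' \<circ> x \<circ> b'') v = conjugation_average (b' \<circ> x \<circ> b'') v"
        by (simp only: conjugation_average_id)
      also have "\<dots> = (\<Sum>g\<in>carrier G. \<Sum>p\<in>V_basis \<times> V_basis. coord (fst p) (x (snd p)) *s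
          (1 / order_K) *s \<rho> g (b' (matrix_unit p (b'' (\<rho> (inv g) v)))))"
        unfolding conjugation_average_def comp_apply
      proof (rule sum.cong[OF refl])
        fix g assume g: "g \<in> carrier G"
        show "(1 / order_K) *s \<rho> g (b' (x (b'' (\<rho> (inv g) v)))) =
          (\<Sum>p\<in>V_basis \<times> V_basis. coord (fst p) (x (snd p)) *s
            (1 / order_K) *s \<rho> g (b' (matrix_unit p (b'' (\<rho> (inv g) v)))))"
          by (subst matrix_unit_expansion[OF lx])
            (simp add: linear_opD[OF l'] linear_opD[OF linear_rep[OF g]] scale_sum_right mult.commute)
      qed
      also have "\<dots> = (\<Sum>p\<in>V_basis \<times> V_basis. \<Sum>g\<in>carrier G. coord (fst p) (x (snd p)) *s
          (1 / order_K) *s \<rho> g (b' (matrix_unit p (b'' (\<rho> (inv g) v)))))"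
        by (rule sum.swap)
      also have "\<dots> = (\<Sum>p\<in>V_basis \<times> V_basis. alg_scale BG (coord (fst p) (x (snd p)))
        (conjugation_average (b' \<circ> matrix_unit p \<circ> b''))) v"
        unfolding sum_fun_apply intertwiner_simps conjugation_average_def comp_apply scale_sum_right ..
      finally show "(b' \<circ> x \<circ> b'') v = (\<Sum>p\<in>V_basis \<times> V_basis. alg_scale BG (coord (fst p) (x (snd p)))
        (conjugation_average (b' \<circ> matrix_unit p \<circ> b''))) v" .
    qed
  qed (simp_all add: F V_basis conjugation_average_intertwines lin intertwiner_simps coord_add coord_scale)
  also have "\<dots> = (\<Sum>p\<in>V_basis \<times> V_basis. \<Sum>g\<in>carrier G.
      coord (fst p) ((\<rho> g \<circ> b') (fst p)) * coord (snd p) ((b'' \<circ> \<rho> (inv g)) (snd p)) / order_K)"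
    unfolding conjugation_average_def coord_sum
    by (intro sum.cong refl)
      (simp add: matrix_unit_def coord_scale linear_opD[OF l'] linear_opD[OF linear_rep] mult.commute)
  also have "\<dots> = (\<Sum>g\<in>carrier G. \<Sum>p\<in>V_basis \<times> V_basis.
      coord (fst p) ((\<rho> g \<circ> b') (fst p)) * coord (snd p) ((b'' \<circ> \<rho> (inv g)) (snd p)) / order_K)"
    by (rule sum.swap)
  also have "\<dots> = (\<Sum>g\<in>carrier G. Tr (\<rho> g \<circ> b') * Tr (\<rho> (inv g) \<circ> b'') / order_K)"
  proof (rule sum.cong[OF refl])
    fix g assume g: "g \<in> carrier G"
    \<comment> \<open>The matrix units produce \<open>b'' \<circ> \<rho> (inv g)\<close> with the factors in this order.\<close>
    have comm: "\<rho> (inv g) \<circ> b'' = b'' \<circ> \<rho> (inv g)"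
      using g b'' by (simp add: intertwiner_space fun_eq_iff)
    have "Tr (\<rho> g \<circ> b') * Tr (\<rho> (inv g) \<circ> b'') =
        (\<Sum>i\<in>V_basis. coord i ((\<rho> g \<circ> b') i)) * (\<Sum>j\<in>V_basis. coord j ((b'' \<circ> \<rho> (inv g)) j))"
      unfolding comm using g l' l'' by (subst (1 2) Tr_basis) (simp_all add: linear_op_comp linear_rep)
    then show "(\<Sum>p\<in>V_basis \<times> V_basis. coord (fst p) ((\<rho> g \<circ> b') (fst p)) *
        coord (snd p) ((b'' \<circ> \<rho> (inv g)) (snd p)) / order_K) =
        Tr (\<rho> g \<circ> b') * Tr (\<rho> (inv g) \<circ> b'') / order_K"
      by (simp add: sum_product sum.cartesian_product case_prod_beta sum_divide_distrib)
  qed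
  also have "\<dots> = (\<Sum>g\<in>carrier G. Tr (\<rho> g \<circ> b') * Tr (\<rho> (inv g) \<circ> b'')) / order_K"
    by (simp add: sum_divide_distrib)
  finally show ?thesis .
qed

end

section \<open>The twisted trace form and the Cardy condition\<close>

locale twisted_representation = nonmodular_representation G scale \<rho> "field_type :: 'k itself" +
    central_unit G "field_type :: 'k itself" \<mu> \<nu>
  for G :: "('g, 'm) monoid_scheme" (structure)
    and scale :: "'k::field \<Rightarrow> 'v::ab_group_add \<Rightarrow> 'v" (infixr "*s" 75) and \<rho> and field_type and \<mu> \<nu>
begin

abbreviation lB :: "('v \<Rightarrow> 'v) \<Rightarrow> 'k" where "lB \<equiv> intertwiner_functional G scale \<rho> \<mu>"

text \<open>
  The scalar is pulled out of the trace; the remaining operator is the composition to which the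
  cyclic property and the criterion on square-zero operators apply.
\<close>

lemma intertwiner_functional_eq:
  assumes "linear_op x"
  shows "lB x = Tr (\<Phi> \<mu> \<circ> x) / order_K"
proof -
  have "lB x = Tr (\<lambda>v. (1 / order_K) *s (\<Phi> \<mu> \<circ> x) v)"
    by (simp add: intertwiner_functional_def)
  also have "\<dots> = (1 / order_K) * Tr (\<Phi> \<mu> \<circ> x)"
    by (rule Tr_scaled[OF linear_op_comp[OF linear_action assms]])
  finally show ?thesis by simp
qed

lemma intertwiner_frobenius_pair: "frobenius_pair BG lB"
proof
  note lin = intertwiner_linear
  show "lB (x + y) = lB x + lB y" if "x \<in> alg_space BG" "y \<in> alg_space BG" for x y
  proof -
    have xy: "x + y \<in> alg_space BG" using that B.subspace_add[OF B.subspace_space] by blast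
    show ?thesis
      using that lin[OF xy]
      by (simp add: intertwiner_functional_eq lin Tr_basis linear_op_comp linear_action
          linear_opD[OF linear_action] coord_add sum.distrib add_divide_distrib)
  qed
  show "lB (alg_scale BG c x) = c * lB x" if "x \<in> alg_space BG" for c x
  proof -
    have cx: "alg_scale BG c x \<in> alg_space BG" using that B.subspace_scale[OF B.subspace_space] by blast
    have eq: "\<Phi> \<mu> \<circ> alg_scale BG c x = (\<lambda>v. c *s (\<Phi> \<mu> \<circ> x) v)"
      by (simp add: intertwiner_simps linear_opD[OF linear_action] fun_eq_iff)
    have "Tr (\<Phi> \<mu> \<circ> alg_scale BG c x) = c * Tr (\<Phi> \<mu> \<circ> x)"
      unfolding eq by (rule Tr_scaled[OF linear_op_comp[OF linear_action lin[OF that]]])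
    then show ?thesis
      using intertwiner_functional_eq[OF lin[OF that]] intertwiner_functional_eq[OF lin[OF cx]] by simp
  qed
  show "frob_form BG lB x y = frob_form BG lB y x" if x: "x \<in> alg_space BG" and y: "y \<in> alg_space BG" for x y
  proof -
    have "Tr (\<Phi> \<mu> \<circ> (x \<circ> y)) = Tr ((\<Phi> \<mu> \<circ> x) \<circ> y)" by (simp add: comp_assoc)
    also have "\<dots> = Tr (y \<circ> (\<Phi> \<mu> \<circ> x))"
      using x y by (intro Tr_commute) (simp_all add: lin linear_op_comp linear_action)
    also have "y \<circ> (\<Phi> \<mu> \<circ> x) = \<Phi> \<mu> \<circ> (y \<circ> x)"
      using y by (simp add: fun_eq_iff action_intertwiner_commute)
    finally show ?thesis
      using x y by (simp only: frob_form_def intertwiner_simps intertwiner_functional_eq lin linear_op_comp)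
  qed
  show "x = 0" if x: "x \<in> alg_space BG" and zero: "\<forall>y\<in>alg_space BG. frob_form BG lB x y = 0" for x
  proof -
    have "\<Phi> \<mu> \<circ> x = 0"
    proof (rule intertwiner_form_nondegenerate)
      show "\<Phi> \<mu> \<circ> x \<in> alg_space BG"
        using x unit_central by (simp add: intertwiner_closed central_action_intertwines)
      show "Tr (\<Phi> \<mu> \<circ> x \<circ> y) = 0" if y: "y \<in> alg_space BG" for y
        using bspec[OF zero y] x y order_nonzero
        by (simp add: frob_form_def intertwiner_simps intertwiner_functional_eq lin linear_op_comp comp_assoc)
    qed
    moreover have "\<Phi> \<nu> \<circ> (\<Phi> \<mu> \<circ> x) = x"
      by (simp add: action_one inverse_unit flip: action_mult comp_assoc)
    ultimately have "x v = \<Phi> \<nu> 0" for v by (simp add: fun_eq_iff)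
    then show "x = 0" using linear_opD(2)[OF linear_action, of \<nu> 0 0] by (simp add: fun_eq_iff)
  qed
qed

text \<open>
  If \<open>x \<circ> x = 0\<close>, then \<open>\<Phi> \<mu> \<circ> x\<close> also has square zero, because \<open>\<Phi> \<mu>\<close> commutes with \<open>x\<close>.
\<close>

lemma semisimple_intertwiners: "semisimple_alg BG"
proof (rule frobenius_pair.semisimple_if_kills_square_zero[OF intertwiner_frobenius_pair])
  fix x assume x: "x \<in> alg_space BG" and "alg_mult BG x x = 0"
  then have xx: "x (x v) = 0" for v by (simp add: intertwiner_simps fun_eq_iff)
  have z: "\<Phi> y 0 = 0" for y using linear_opD(2)[OF linear_action, of y 0 0] by simp
  have "(\<Phi> \<mu> \<circ> x) \<circ> (\<Phi> \<mu> \<circ> x) = 0"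
    by (simp add: fun_eq_iff xx z flip: action_intertwiner_commute[OF x])
  then have "Tr (\<Phi> \<mu> \<circ> x) = 0"
    using x by (intro trace_square_zero) (simp_all add: linear_op_comp linear_action intertwiner_linear)
  then show "lB x = 0" using x by (simp add: intertwiner_functional_eq intertwiner_linear)
qed

text \<open>
  Of the factor \<open>\<mu>\<^sup>2\<close> in \<open>l\<^sub>A\<close> one \<open>\<mu>\<close> cancels against \<open>\<nu>\<close>, and the other one is the \<open>\<mu>\<close> in
  \<open>l\<^sub>B\<close>.
\<close>

lemma dual_map_character_sum:
  assumes b: "b \<in> alg_space BG"
  shows "dual_map ZKG (center_functional G \<mu>) BG lB \<Phi> b = \<nu> \<star> character_sum b"
proof (rule A.dual_map_eqI)
  note T = character_sum_central[OF b]
  show "\<nu> \<star> character_sum b \<in> alg_space ZKG"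
    using KG.center_mult_closed[OF inverse_central T] by (simp add: center_algebra_simps)
  fix a assume "a \<in> alg_space ZKG"
  then have a: "a \<in> alg_center KG" by (simp add: center_algebra_simps)
  have "\<mu> \<star> \<mu> \<star> (\<nu> \<star> character_sum b \<star> a) = \<mu> \<star> character_sum b \<star> a"
    by (simp add: conv_assoc unit_inverse_cancel conv_closed)
  also have "\<dots> = character_sum b \<star> (\<mu> \<star> a)"
    using center_commute[OF unit_central center_space[OF T]] by (simp add: conv_assoc)
  finally have "frob_form ZKG (center_functional G \<mu>) (\<nu> \<star> character_sum b) a =
      (character_sum b \<star> (\<mu> \<star> a)) \<one> / order_K"
    by (simp add: frob_form_def center_algebra_simps center_functional_eq)
  also have "\<dots> = Tr (\<Phi> \<mu> \<circ> (\<Phi> a \<circ> b)) / order_K"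
    by (simp add: character_sum_pairing intertwiner_linear[OF b] action_mult comp_assoc)
  also have "\<Phi> a \<circ> b = b \<circ> \<Phi> a"
    by (simp add: fun_eq_iff action_intertwiner_commute[OF b])
  also have "Tr (\<Phi> \<mu> \<circ> (b \<circ> \<Phi> a)) / order_K = frob_form BG lB b (\<Phi> a)"
    by (simp add: frob_form_def intertwiner_simps intertwiner_functional_eq intertwiner_linear[OF b]
        linear_op_comp linear_action)
  finally show "frob_form ZKG (center_functional G \<mu>) (\<nu> \<star> character_sum b) a =
      frob_form BG lB b (\<Phi> a)" .
qed

text \<open>
  Two dual maps contribute \<open>\<nu>\<close> each, which cancels \<open>\<mu>\<^sup>2\<close>. What remains is independent of \<open>\<mu>\<close>:
  the coefficient at the unit of a product of two character sums.
\<close>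

lemma cardy_condition:
  assumes b': "b' \<in> alg_space BG" and b'': "b'' \<in> alg_space BG"
  shows "frob_form ZKG (center_functional G \<mu>) (\<nu> \<star> character_sum b') (\<nu> \<star> character_sum b'') =
    B.trace_on (alg_space BG) (\<lambda>b. b' \<circ> b \<circ> b'')"
proof -
  note T' = character_sum_central[OF b'] and T'' = character_sum_central[OF b'']
  have "\<mu> \<star> \<mu> \<star> (\<nu> \<star> character_sum b' \<star> (\<nu> \<star> character_sum b'')) =
      \<mu> \<star> character_sum b' \<star> (\<nu> \<star> character_sum b'')"
    by (simp add: conv_assoc unit_inverse_cancel conv_closed)
  also have "\<dots> = character_sum b' \<star> (\<mu> \<star> (\<nu> \<star> character_sum b''))"
    using center_commute[OF unit_central center_space[OF T']] by (simp add: conv_assoc)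
  also have "\<dots> = character_sum b' \<star> character_sum b''"
    by (simp add: unit_inverse_cancel center_space[OF T''])
  finally have "frob_form ZKG (center_functional G \<mu>) (\<nu> \<star> character_sum b') (\<nu> \<star> character_sum b'') =
      (character_sum b' \<star> character_sum b'') \<one> / order_K"
    by (simp add: frob_form_def center_algebra_simps center_functional_eq)
  also have "\<dots> = (\<Sum>g\<in>carrier G. Tr (\<rho> g \<circ> b') * Tr (\<rho> (inv g) \<circ> b'')) / order_K"
    by (simp add: conv_apply' character_sum_def)
  also have "\<dots> = B.trace_on (alg_space BG) (\<lambda>b. b' \<circ> b \<circ> b'')"
    by (rule trace_two_sided_multiplication[OF b' b'', symmetric])
  finally show ?thesis .
qed

lemma semisimple_cardy_frobenius_H: "semisimple_cardy_frobenius_algebra (H_algebra G scale \<rho> \<mu>)"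
proof -
  have "frob_form ZKG (center_functional G \<mu>)
      (dual_map ZKG (center_functional G \<mu>) BG lB \<Phi> b')
      (dual_map ZKG (center_functional G \<mu>) BG lB \<Phi> b'') =
    B.trace_on (alg_space BG) (\<lambda>b. alg_mult BG (alg_mult BG b' b) b'')"
    if "b' \<in> alg_space BG" "b'' \<in> alg_space BG" for b' b''
    using that by (simp add: dual_map_character_sum cardy_condition intertwiner_simps)
  then show ?thesis
    by (simp add: H_algebra_def center_frobenius_pair KG.commutative_center
        intertwiner_frobenius_pair central_action_hom central_action_central semisimple_center
        semisimple_intertwiners)
qed

end

theorem proposition4:
  fixes G :: "('g, 'm) monoid_scheme"
    and scale :: "'k::field \<Rightarrow> 'v::ab_group_add \<Rightarrow> 'v"
    and \<rho> :: "'g \<Rightarrow> 'v \<Rightarrow> 'v"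
    and \<mu> :: "'g \<Rightarrow> 'k"
  assumes "group G" and "finite (carrier G)"
    and "\<not> CHAR('k) dvd card (carrier G)"
    and "fd_representation G scale \<rho>"
    and "alg_invertible (center_algebra (group_algebra G)) \<mu>"
  shows "semisimple_cardy_frobenius_algebra (H_algebra G scale \<rho> \<mu>)"
proof -
  obtain \<nu> where \<nu>: "\<mu> \<in> alg_center (group_algebra G)" "\<nu> \<in> alg_center (group_algebra G)"
    "alg_mult (group_algebra G) \<nu> \<mu> = alg_one (group_algebra G)"
    using assms(5) by (auto simp: alg_invertible_def center_algebra_def)
  have "(of_nat (card (carrier G)) :: 'k) \<noteq> 0"
    using assms(3) by (simp add: of_nat_eq_0_iff_char_dvd)
  then interpret nonmodular_group G "TYPE('k)"
    using assms(1,2) by (simp add: nonmodular_group_def nonmodular_group_axioms_def)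
  interpret twisted_representation G scale \<rho> "TYPE('k)" \<mu> \<nu>
    using assms(4) nonmodular_group_axioms \<nu>
    by (simp add: twisted_representation_def nonmodular_representation_def central_unit_def
        central_unit_axioms_def)
  show ?thesis by (rule semisimple_cardy_frobenius_H)
qed

end
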